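(* Let $S=R^\omega$ be the ring of $\omega$-invariants in $R=\mathbb{F}_2[w_1,w_2,w_3,\dots]$, let $\mathit{PS}\subset S$ be the subring generated by the power sums, and let $F$ be the free commutative $\mathit{PS}$-algebra on the symbols $\delta a$, with $a$ ranging over square-free monomials of strictly positive degree in the variables $w_{2i}$ ($i\ge 1$). Then the $\mathit{PS}$-algebra $S$ is $F$ modulo the relations (1) and (2) below. That is, the $\mathit{PS}$-algebra homomorphism $F\to S$ with $\delta a\mapsto da=a+\overline{a}$ is surjective, and its kernel is the ideal generated by the following relations: (1) for every odd $k\ge 1$, $$p_k^2=\sum_{i=0}^{(k-1)/2}\bigl[\delta(w_{2i}w_{2(k-i)})+\delta(w_{2i})\,\delta(w_{2(k-i)})\bigr];$$ (2) for every triple $(x,y,z)$ of square-free monomials in the variables $w_{2i}$, $$\delta(yz)\,\delta x+\delta(xz)\,\delta y+\delta(xy)\,\delta z=\delta x\,\delta y\,\delta z .$$ Here $\delta x\in F$ for a general $x\in R$ is the extension of the notation described in the context (the products $xy,xz,yz$ in (2) need not be square-free).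
   Context: $R=\mathbb{F}_2[w_1,w_2,w_3,\dots]$ is the polynomial ring graded by $\deg w_i=i$, with the convention $w_0=1$. The ring involution $\omega\colon R\to R$, $x\mapsto\overline{x}$, is defined recursively by $\sum_{i=0}^k w_i\overline{w}_{k-i}=0$ for $k\ge 1$ (with $\overline{w}_0=1$). (This is the ring of symmetric functions over $\mathbb{F}_2$ with the standard involution interchanging elementary and complete homogeneous symmetric functions.) Put $dx=x+\overline{x}$ for $x\in R$. The power sums $p_k\in R$ ($k\ge 1$) are defined recursively by the Newton identity $k w_k=\sum_{j=0}^{k-1}p_{k-j}w_j$. They are $\omega$-invariant and satisfy $p_k^2=p_{2k}$. $\mathit{PS}$ is the subring generated by all $p_k$. "Square-free monomial" means a product of distinct variables (the empty product $1$ is allowed unless positive degree is required). Extension of $\delta$ to $R$: it is known that $R$ has an $\mathbb{F}_2$-basis ("standard form") consisting of all elements $p\,a\,dw_{2i_1}\cdots dw_{2i_n}$, where $p$ is a square-free monomial in the variables $p_{2i-1}$ ($i\ge1$), $a$ is a square-free monomial in the variables $w_{2i}$ ($i\ge 1$), and $1\le i_1\le\dots\le i_n$, $n\ge 0$. For such a basis element $x$ define $\delta x=p\,(\delta a)\,(\delta w_{2i_1})\cdots(\delta w_{2i_n})\in F$, where $\delta a$ is the generator of $F$ if $a\ne 1$ and $\delta 1=0$. Extend $\mathbb{F}_2$-linearly to all $x\in R$. *)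

theory Defs
  imports
    "HOL-Library.Poly_Mapping"
    "HOL-Library.Multiset"
    "HOL-Library.Z2"
    "HOL-Algebra.Generated_Rings"
    "HOL-Algebra.RingHom"
begin

text \<open>Polynomials in commuting variables of type \<^typ>\<open>'v\<close> are finitely supported functions
  on exponent vectors.\<close>

type_synonym ('v, 'a) mpol = "('v \<Rightarrow>\<^sub>0 nat) \<Rightarrow>\<^sub>0 'a"

definition Const :: "'a \<Rightarrow> ('v, 'a::comm_ring_1) mpol"
  where "Const c = Poly_Mapping.single 0 c"

definition Var :: "'v \<Rightarrow> ('v, 'a::comm_ring_1) mpol"
  where "Var v = Poly_Mapping.single (Poly_Mapping.single v 1) 1"

definition mp_eval ::
    "('a::comm_ring_1 \<Rightarrow> 'b::comm_ring_1) \<Rightarrow> ('v \<Rightarrow> 'b) \<Rightarrow> ('v, 'a) mpol \<Rightarrow> 'b"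
  where "mp_eval c g f =
    (\<Sum>m\<in>Poly_Mapping.keys f. c (Poly_Mapping.lookup f m) *
       (\<Prod>v\<in>Poly_Mapping.keys m. g v ^ Poly_Mapping.lookup m v))"

definition ring_on :: "'a::comm_ring_1 set \<Rightarrow> 'a ring"
  where "ring_on A = \<lparr>carrier = A, mult = (*), one = 1, zero = 0, add = (+)\<rparr>"

lemma ring_on_simps [simp]:
  "carrier (ring_on A) = A" "x \<otimes>\<^bsub>ring_on A\<^esub> y = x * y" "\<one>\<^bsub>ring_on A\<^esub> = 1"
  "\<zero>\<^bsub>ring_on A\<^esub> = 0" "x \<oplus>\<^bsub>ring_on A\<^esub> y = x + y"
  by (simp_all add: ring_on_def)

lemma cring_ring_on:
  assumes "1 \<in> A" and "\<And>x. x \<in> A \<Longrightarrow> - x \<in> A"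
    and add: "\<And>x y. x \<in> A \<Longrightarrow> y \<in> A \<Longrightarrow> x + y \<in> A"
    and "\<And>x y. x \<in> A \<Longrightarrow> y \<in> A \<Longrightarrow> x * y \<in> A"
  shows "cring (ring_on A)"
proof -
  have z: "0 \<in> A"
    using add[of 1 "- 1"] assms(1,2) by simp
  show ?thesis
  proof (rule cringI)
    show "abelian_group (ring_on A)"
    proof (rule abelian_groupI)
      fix x assume "x \<in> carrier (ring_on A)"
      then show "\<exists>y\<in>carrier (ring_on A). y \<oplus>\<^bsub>ring_on A\<^esub> x = \<zero>\<^bsub>ring_on A\<^esub>"
        using assms(2) by (intro bexI[of _ "- x"]) auto
    qed (use z add in \<open>auto simp: algebra_simps\<close>)
    show "comm_monoid (ring_on A)"
      by (rule comm_monoidI) (use assms in \<open>auto simp: algebra_simps\<close>)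
  qed (auto simp: algebra_simps)
qed

lemma a_inv_ring_on_UNIV [simp]: "\<ominus>\<^bsub>ring_on UNIV\<^esub> x = - x"
proof -
  interpret cring "ring_on (UNIV :: 'a set)"
    by (rule cring_ring_on) auto
  show ?thesis
    by (rule minus_equality) auto
qed

text \<open>The variable with index \<open>n\<close> is $w_{n+1}$.\<close>

type_synonym R = "(nat, bit) mpol"

fun w :: "nat \<Rightarrow> R"
  where
    "w 0 = 1"
  | "w (Suc n) = Var n"

fun wbar :: "nat \<Rightarrow> R"
  where "wbar k = (if k = 0 then 1 else - (\<Sum>i\<in>{1..k}. w i * wbar (k - i)))"

declare wbar.simps [simp del]

lemma wbar_0: "wbar 0 = 1"
  by (simp add: wbar.simps)

lemma wbar_recursion:
  assumes "k \<ge> 1"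
  shows "(\<Sum>i=0..k. w i * wbar (k - i)) = 0"
proof -
  have "(\<Sum>i=0..k. w i * wbar (k - i)) = wbar k + (\<Sum>i\<in>{1..k}. w i * wbar (k - i))"
    by (simp add: sum.atLeast_Suc_atMost)
  also have "wbar k = - (\<Sum>i\<in>{1..k}. w i * wbar (k - i))"
    using assms by (subst wbar.simps) auto
  finally show ?thesis by simp
qed

definition omega :: "R \<Rightarrow> R"
  where "omega = mp_eval Const (\<lambda>n. wbar (Suc n))"

lemma omega_w: "omega (w k) = wbar k"
  by (cases k) (auto simp: omega_def mp_eval_def Var_def Const_def wbar_0 single_one
      simp flip: single_one)

definition d :: "R \<Rightarrow> R"
  where "d x = x + omega x"

definition S :: "R set"
  where "S = {x. omega x = x}"

text \<open>The Newton identity solved for its \<open>j = 0\<close> summand; only the values at \<open>k \<ge> 1\<close> matter.\<close>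

fun psum :: "nat \<Rightarrow> R"
  where "psum k = of_nat k * w k - (\<Sum>j\<in>{1..<k}. psum (k - j) * w j)"

declare psum.simps [simp del]

lemma newton_identity:
  assumes "k \<ge> 1"
  shows "of_nat k * w k = (\<Sum>j=0..<k. psum (k - j) * w j)"
proof -
  have "(\<Sum>j=0..<k. psum (k - j) * w j) = psum k + (\<Sum>j\<in>{1..<k}. psum (k - j) * w j)"
    using assms by (simp add: sum.atLeast_Suc_lessThan)
  also have "psum k = of_nat k * w k - (\<Sum>j\<in>{1..<k}. psum (k - j) * w j)"
    by (rule psum.simps)
  finally show ?thesis by simp
qed

definition PS :: "R set"
  where "PS = generate_ring (ring_on UNIV) (psum ` {1..})"

definition sqf_even :: "nat set \<Rightarrow> R"
  where "sqf_even A = (\<Prod>i\<in>A. w (2 * i))"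

definition sqf_monomials :: "R set"
  where "sqf_monomials = {sqf_even A |A. finite A \<and> A \<subseteq> {1..}}"

definition pos_sqf_monomials :: "R set"
  where "pos_sqf_monomials = {sqf_even A |A. finite A \<and> A \<subseteq> {1..} \<and> A \<noteq> {}}"

text \<open>The variable \<^term>\<open>Var a\<close> is the symbol $\delta a$, so the monomials \<open>a\<close> themselves index
  the variables.  The ambient polynomial ring has a variable for every element of $R$ and
  coefficients in all of $R$; \<open>F\<close> is its subring with the right variables and coefficients.\<close>

type_synonym F_ambient = "(R, R) mpol"

definition F :: "F_ambient set"
  where "F = {f. \<forall>m\<in>Poly_Mapping.keys f.
    Poly_Mapping.lookup f m \<in> PS \<and> Poly_Mapping.keys m \<subseteq> pos_sqf_monomials}"

definition F_to_S :: "F_ambient \<Rightarrow> R"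
  where "F_to_S = mp_eval (\<lambda>c. c) d"

text \<open>The triple \<open>(P, A, I)\<close> indexes the standard form basis element
  $\prod_{i \in P} p_{2i-1} \cdot \prod_{i \in A} w_{2i} \cdot \prod_{i \in I} dw_{2i}$; the
  multiset \<open>I\<close> stands for the sequence $i_1 \le \dots \le i_n$.\<close>

type_synonym std_index = "nat set \<times> nat set \<times> nat multiset"

definition std_indices :: "std_index set"
  where "std_indices =
    {(P, A, I). finite P \<and> P \<subseteq> {1..} \<and> finite A \<and> A \<subseteq> {1..} \<and> set_mset I \<subseteq> {1..}}"

definition std_elt :: "std_index \<Rightarrow> R"
  where "std_elt = (\<lambda>(P, A, I).
    (\<Prod>i\<in>P. psum (2 * i - 1)) * sqf_even A * (\<Prod>i\<in>#I. d (w (2 * i))))"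

definition delta_sqf :: "R \<Rightarrow> F_ambient"
  where "delta_sqf a = (if a = 1 then 0 else Var a)"

definition delta_std :: "std_index \<Rightarrow> F_ambient"
  where "delta_std = (\<lambda>(P, A, I).
    Const (\<Prod>i\<in>P. psum (2 * i - 1)) * delta_sqf (sqf_even A) *
      (\<Prod>i\<in>#I. delta_sqf (w (2 * i))))"

text \<open>Over $\mathbb{F}_2$ the expansion of \<open>x\<close> in the standard form basis is a finite set of
  basis elements with sum \<open>x\<close>; it exists and is unique because the standard form elements, indexed
  by \<^const>\<open>std_indices\<close>, are a basis of $R$.\<close>

definition std_expansion :: "R \<Rightarrow> std_index set"
  where "std_expansion x =
    (THE T. finite T \<and> T \<subseteq> std_indices \<and> (\<Sum>t\<in>T. std_elt t) = x)"

definition delta :: "R \<Rightarrow> F_ambient"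
  where "delta x = (\<Sum>t\<in>std_expansion x. delta_std t)"

definition relations1 :: "F_ambient set"
  where "relations1 =
    {Const ((psum k)\<^sup>2) -
      (\<Sum>i=0..(k - 1) div 2.
         delta (w (2 * i) * w (2 * (k - i))) + delta (w (2 * i)) * delta (w (2 * (k - i))))
     |k. odd k}"

definition relations2 :: "F_ambient set"
  where "relations2 =
    {delta (y * z) * delta x + delta (x * z) * delta y + delta (x * y) * delta z
       - delta x * delta y * delta z
     |x y z. x \<in> sqf_monomials \<and> y \<in> sqf_monomials \<and> z \<in> sqf_monomials}"

lemma PS_one: "1 \<in> PS"
  using generate_ring.one[of "ring_on (UNIV :: R set)"] unfolding PS_def by simp

lemma PS_uminus: "x \<in> PS \<Longrightarrow> - x \<in> PS"
  using generate_ring.a_inv[of x "ring_on UNIV"] unfolding PS_def by simp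

lemma PS_add: "x \<in> PS \<Longrightarrow> y \<in> PS \<Longrightarrow> x + y \<in> PS"
  using generate_ring.eng_add[of x "ring_on UNIV"] unfolding PS_def by simp

lemma PS_mult: "x \<in> PS \<Longrightarrow> y \<in> PS \<Longrightarrow> x * y \<in> PS"
  using generate_ring.eng_mult[of x "ring_on UNIV"] unfolding PS_def by simp

lemma PS_zero: "0 \<in> PS"
  using PS_add[OF PS_one PS_uminus[OF PS_one]] by simp

lemma F_iff:
  "f \<in> F \<longleftrightarrow> (\<forall>m. Poly_Mapping.lookup f m \<in> PS) \<and>
     (\<forall>m\<in>Poly_Mapping.keys f. Poly_Mapping.keys m \<subseteq> pos_sqf_monomials)"
  unfolding F_def by (auto simp: in_keys_iff) (metis PS_zero in_keys_iff)

lemma PS_sum: "(\<And>i. i \<in> A \<Longrightarrow> g i \<in> PS) \<Longrightarrow> sum g A \<in> PS"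
  by (induction A rule: infinite_finite_induct) (auto intro: PS_zero PS_add)

lemma cring_F: "cring (ring_on F)"
proof (rule cring_ring_on)
  show "1 \<in> F"
    by (auto simp: F_iff lookup_one when_def PS_one PS_zero)
next
  fix f assume "f \<in> F" then show "- f \<in> F"
    by (auto simp: F_iff PS_uminus)
next
  fix f g assume "f \<in> F" "g \<in> F" then show "f + g \<in> F"
    using keys_add[of f g] by (auto simp: F_iff lookup_add PS_add) blast
next
  fix f g assume fg: "f \<in> F" "g \<in> F"
  have "Poly_Mapping.lookup (f * g) m \<in> PS" for m
    using fg unfolding lookup_mult Sum_any.expand_set
    by (auto simp: F_iff when_def intro!: PS_sum PS_mult PS_zero)
  moreover have "Poly_Mapping.keys m \<subseteq> pos_sqf_monomials" if m: "m \<in> Poly_Mapping.keys (f * g)" for m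
  proof -
    obtain a b where "a \<in> Poly_Mapping.keys f" "b \<in> Poly_Mapping.keys g" "m = a + b"
      using m keys_mult[of f g] by blast
    then show ?thesis
      using fg keys_add[of a b] by (auto simp: F_iff) blast
  qed
  ultimately show "f * g \<in> F"
    by (simp add: F_iff)
qed

end

theory Submission
  imports Defs "HOL-Computational_Algebra.Formal_Power_Series"
begin

text \<open>
  The lowest-length part of a standard form element is a monomial in the $w_i$: that of $p_{2i-1}$ is
  $w_{2i-1}$ and that of $dw_{2i}$ is $w_i^2$. Every monomial arises exactly once, so the standard form
  elements are a basis, and $\delta$ makes sense. It lifts $d$ along $F \to S$.

  In this basis $d$ is linear over the $p_{2i-1}$ that occur and over the $dw_{2i}$, and it is a
  tensor product over $i$ of copies of $\mathbb{F}_2[y]\{1,u\}$ with $\overline u = u + y$. Contracting each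
  of them gives a homotopy $h$ with $dh + hd = 1 + \epsilon$, where $\epsilon$ projects to the span of the
  squarefree products of odd power sums. Hence $S = \epsilon S + dR$, which is surjectivity.

  Modulo the relations, $\delta$ is $\mathit{PS}$-linear, $\delta d = 0$, and every element of $F$ has the form
  $c + \delta x$ with $c$ in the image of $\epsilon$. If this maps to $c + dx = 0$, then $c = 0$ and
  $x = \epsilon x + dhx$, so that $\delta x = \delta d h x$ vanishes modulo the relations.
\<close>

section \<open>Characteristic two\<close>

text \<open>The relations enter because \<open>delta\<close> is known only on the standard basis.
  Multiplication by \<open>d (w (2 * i))\<close> with i \<ge> 1 maps that basis into itself, so
  \<open>delta\<close> is linear over it on the nose. Multiplication by an odd power sum p_k leaves
  the basis as soon as p_k is already a factor, and p_k^2 must be expanded again. The expansion is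
  read off from generating functions: for W = sum w_i t^i and its conjugate Wbar one has W Wbar = 1
  and P = t W' Wbar, so p_k^2 = p_{2k} is the sum of w_i wbar_{2k-i} over odd i, or equally over
  even i. Its lift to F is relation (1). The other power sums then stand in front of an element that
  need not be in standard form, which forces an induction on degree. Relation (2) is the consequence
  of d(xy) = dx y + x dy + dx dy that involves only values of d. It makes up for
  \<open>delta\<close> being linear by construction only over the \<open>d (w (2 * i))\<close>: a
  product of symbols of long monomials is traded for products in which one factor belongs to a
  shorter monomial, down to a single variable.\<close>

class char_two = comm_ring_1 +
  assumes two_eq_0 [simp]: "2 = 0"
begin

lemma add_self [simp]: "x + x = 0"
  using mult_2[of x] by simp

lemma add_self_left [simp]: "x + (x + y) = y"
  by (simp flip: add.assoc)

lemma uminus_eq_self [simp]: "- x = x"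
  using add_self by (rule minus_unique)

lemma diff_eq_add [simp]: "x - y = x + y"
  using diff_conv_add_uminus by simp

lemma add_eq_0_iff_eq: "x + y = 0 \<longleftrightarrow> x = y"
  by (metis add_self add_self_left add_0_right)

lemma of_nat_even_odd: "of_nat n = (if odd n then 1 else 0)"
  by (induction n)  auto

end

instance bit :: char_two
  by standard simp

instance poly_mapping :: (comm_monoid_add, char_two) char_two
proof
  show "2 = (0 :: 'a \<Rightarrow>\<^sub>0 'b)"
    by (rule poly_mapping_eqI) (simp add: lookup_numeral)
qed

text \<open>Common elements cancel in characteristic 2. Expansions over F_2 are finite sets, and
  their addition is symmetric difference.\<close>

lemma sum_sym_diff:
  fixes f :: "'a \<Rightarrow> 'b::char_two"
  assumes "finite A" "finite B"
  shows "sum f (sym_diff A B) = sum f A + sum f B"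
proof -
  have "sum f (sym_diff A B) = sum f (A - B) + sum f (B - A)"
    using assms by (intro sum.union_disjoint) auto
  moreover have "sum f A = sum f (A - B) + sum f (A \<inter> B)"
    using assms by (metis add.commute sum.Int_Diff)
  moreover have "sum f B = sum f (B - A) + sum f (A \<inter> B)"
    using assms by (metis add.commute sum.Int_Diff inf_commute)
  ultimately show ?thesis
    by (simp add: ac_simps)
qed

text \<open>The reflection i -> 2k - i pairs off all terms except the middle one. This is the source
  of the squares in \<open>psum_square\<close> and in the leading term of
  \<open>d (w (2 * i))\<close>.\<close>

lemma sum_palindrome:
  fixes f :: "nat \<Rightarrow> 'b::char_two"
  assumes "\<And>i. i \<le> 2 * k \<Longrightarrow> f (2 * k - i) = f i"
  shows "(\<Sum>i=0..2*k. f i) = f k"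
proof -
  have "(\<Sum>i=0..2*k. f i) = (\<Sum>i\<in>{0..<k}. f i) + (\<Sum>i\<in>{k..2*k}. f i)"
    by (subst sum.union_disjoint [symmetric]) (auto intro!: sum.cong)
  also have "(\<Sum>i\<in>{k..2*k}. f i) = f k + (\<Sum>i\<in>{Suc k..2*k}. f i)"
    by (simp add: sum.atLeast_Suc_atMost)
  also have "(\<Sum>i\<in>{Suc k..2*k}. f i) = (\<Sum>i\<in>{0..<k}. f i)"
    using assms by (intro sum.reindex_bij_witness[of _ "\<lambda>i. 2*k - i" "\<lambda>i. 2*k - i"]) auto
  finally show ?thesis
    by (simp add: ac_simps)
qed

lemma poly_mapping_sum_single: "(\<Sum>m\<in>Poly_Mapping.keys f. Poly_Mapping.single m (Poly_Mapping.lookup f m)) = f"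
proof (rule poly_mapping_eqI)
  fix k
  show "Poly_Mapping.lookup (\<Sum>m\<in>Poly_Mapping.keys f. Poly_Mapping.single m (Poly_Mapping.lookup f m)) k
    = Poly_Mapping.lookup f k"
    by (auto simp: lookup_sum lookup_single when_def in_keys_iff)
qed

section \<open>Evaluation of polynomials\<close>

definition monom_eval :: "('v \<Rightarrow> 'b::comm_ring_1) \<Rightarrow> ('v \<Rightarrow>\<^sub>0 nat) \<Rightarrow> 'b"
  where "monom_eval g m = (\<Prod>v\<in>Poly_Mapping.keys m. g v ^ Poly_Mapping.lookup m v)"

lemma monom_eval_superset:
  assumes "finite A" "Poly_Mapping.keys m \<subseteq> A"
  shows "monom_eval g m = (\<Prod>v\<in>A. g v ^ Poly_Mapping.lookup m v)"
  unfolding monom_eval_def using assms by (intro prod.mono_neutral_left) (auto simp: in_keys_iff)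

lemma monom_eval_add: "monom_eval g (m + n) = monom_eval g m * monom_eval g n"
proof -
  let ?A = "Poly_Mapping.keys m \<union> Poly_Mapping.keys n"
  have "monom_eval g (m + n) = (\<Prod>v\<in>?A. g v ^ Poly_Mapping.lookup (m + n) v)"
    using keys_add[of m n] by (intro monom_eval_superset) auto
  also have "\<dots> = (\<Prod>v\<in>?A. g v ^ Poly_Mapping.lookup m v) * (\<Prod>v\<in>?A. g v ^ Poly_Mapping.lookup n v)"
    by (simp add: lookup_add power_add prod.distrib)
  also have "\<dots> = monom_eval g m * monom_eval g n"
    by (simp add: monom_eval_superset[of ?A])
  finally show ?thesis .
qed

text \<open>There are two instances: coefficients in \<open>bit\<close> embedded by
  \<open>Const\<close>, for \<open>omega\<close>, and coefficients in R left alone, for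
  \<open>F_to_S\<close>.\<close>

locale mp_eval_hom =
  fixes c :: "'a::comm_ring_1 \<Rightarrow> 'b::comm_ring_1" and g :: "'v \<Rightarrow> 'b"
  assumes c_0: "c 0 = 0" and c_1: "c 1 = 1"
    and c_add: "c (x + y) = c x + c y" and c_mult: "c (x * y) = c x * c y"
begin

lemma mp_eval_superset:
  assumes "finite A" "Poly_Mapping.keys f \<subseteq> A"
  shows "mp_eval c g f = (\<Sum>m\<in>A. c (Poly_Mapping.lookup f m) * monom_eval g m)"
  unfolding mp_eval_def monom_eval_def[symmetric] using assms
  by (intro sum.mono_neutral_left) (auto simp: in_keys_iff c_0)

lemma mp_eval_0: "mp_eval c g 0 = 0"
  by (simp add: mp_eval_def)

lemma mp_eval_add: "mp_eval c g (f + h) = mp_eval c g f + mp_eval c g h"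
proof -
  let ?A = "Poly_Mapping.keys f \<union> Poly_Mapping.keys h"
  have "mp_eval c g (f + h) = (\<Sum>m\<in>?A. c (Poly_Mapping.lookup (f + h) m) * monom_eval g m)"
    using keys_add[of f h] by (intro mp_eval_superset) auto
  then show ?thesis
    by (simp add: lookup_add c_add ring_distribs sum.distrib mp_eval_superset[of ?A])
qed

lemma mp_eval_sum: "mp_eval c g (\<Sum>i\<in>I. f i) = (\<Sum>i\<in>I. mp_eval c g (f i))"
  by (induction I rule: infinite_finite_induct) (auto simp: mp_eval_0 mp_eval_add)

lemma mp_eval_single: "mp_eval c g (Poly_Mapping.single m a) = c a * monom_eval g m"
  by (subst mp_eval_superset[of "{m}"]) auto

lemma mp_eval_1: "mp_eval c g 1 = 1"
  by (simp add: mp_eval_single c_1 monom_eval_def flip: single_one)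

lemma mp_eval_Const: "mp_eval c g (Const a) = c a"
  by (simp add: Const_def mp_eval_single monom_eval_def)

lemma mp_eval_Var: "mp_eval c g (Var v) = g v"
  by (simp add: Var_def mp_eval_single monom_eval_def c_1)

lemma mp_eval_mult: "mp_eval c g (f * h) = mp_eval c g f * mp_eval c g h"
proof -
  let ?t = "\<lambda>f m. Poly_Mapping.single m (Poly_Mapping.lookup f m)"
  have "f * h = (\<Sum>m\<in>Poly_Mapping.keys f. ?t f m) * (\<Sum>m\<in>Poly_Mapping.keys h. ?t h m)"
    by (simp add: poly_mapping_sum_single)
  then have "mp_eval c g (f * h) =
    (\<Sum>m\<in>Poly_Mapping.keys f. mp_eval c g (?t f m)) * (\<Sum>m\<in>Poly_Mapping.keys h. mp_eval c g (?t h m))"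
    by (simp add: sum_product mp_eval_sum mult_single mp_eval_single monom_eval_add c_mult ac_simps)
  then show ?thesis
    by (simp add: poly_mapping_sum_single flip: mp_eval_sum)
qed

end

lemma Const_add: "Const (a + b) = Const a + Const b"
  by (simp add: Const_def single_add)

lemma Const_mult: "Const (a * b) = Const a * Const b"
  by (simp add: Const_def mult_single)

lemma Const_0 [simp]: "Const 0 = 0" and Const_1 [simp]: "Const 1 = 1"
  by (simp_all add: Const_def)

section \<open>The involution and the power sums\<close>

interpretation omega: mp_eval_hom "Const :: bit \<Rightarrow> R" "\<lambda>n. wbar (Suc n)"
  by standard (rule Const_0 Const_1 Const_add Const_mult)+

lemma omega_0 [simp]: "omega 0 = 0" and omega_1 [simp]: "omega 1 = 1"
  and omega_add: "omega (x + y) = omega x + omega y"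
  and omega_mult: "omega (x * y) = omega x * omega y"
  and omega_sum: "omega (\<Sum>i\<in>I. f i) = (\<Sum>i\<in>I. omega (f i))"
  unfolding omega_def
  by (simp_all only: omega.mp_eval_0 omega.mp_eval_1 omega.mp_eval_add omega.mp_eval_mult omega.mp_eval_sum)

lemma omega_prod: "omega (\<Prod>i\<in>I. f i) = (\<Prod>i\<in>I. omega (f i))"
  by (induction I rule: infinite_finite_induct) (auto simp: omega_mult)

section \<open>Generating functions of w, wbar and the power sums\<close>

abbreviation W :: "R fps" where "W \<equiv> Abs_fps w"
abbreviation Wbar :: "R fps" where "Wbar \<equiv> Abs_fps wbar"
abbreviation P_fps :: "R fps" where "P_fps \<equiv> Abs_fps (\<lambda>k. if k = 0 then 0 else psum k)"

lemma W_mult_Wbar: "W * Wbar = 1"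
proof (rule fps_ext)
  fix n show "fps_nth (W * Wbar) n = fps_nth 1 n"
    using wbar_recursion[of n] by (cases "n = 0") (auto simp: fps_mult_nth wbar_0)
qed

definition fps_omega :: "R fps \<Rightarrow> R fps"
  where "fps_omega f = Abs_fps (\<lambda>n. omega (fps_nth f n))"

lemma fps_omega_mult: "fps_omega (f * g) = fps_omega f * fps_omega g"
  by (rule fps_ext) (simp add: fps_omega_def fps_mult_nth omega_sum omega_mult)

lemma fps_omega_W: "fps_omega W = Wbar"
  by (rule fps_ext) (simp add: fps_omega_def omega_w)

text \<open>Conjugating W Wbar = 1 shows that the conjugate of Wbar is an inverse of Wbar, as W is.
  Hence \<open>omega\<close> is an involution on generators.\<close>

lemma fps_omega_Wbar: "fps_omega Wbar = W"
proof -
  have "fps_omega (W * Wbar) = 1"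
    unfolding W_mult_Wbar by (rule fps_ext) (simp add: fps_omega_def)
  then have "Wbar * fps_omega Wbar = 1"
    by (simp add: fps_omega_mult fps_omega_W)
  then have "W * Wbar * fps_omega Wbar = W"
    by (simp add: mult.assoc)
  then show ?thesis
    by (simp add: W_mult_Wbar)
qed

lemma omega_wbar: "omega (wbar k) = w k"
  using arg_cong[OF fps_omega_Wbar, of "\<lambda>f. fps_nth f k"] by (simp add: fps_omega_def)

lemma omega_Var: "omega (Var n) = wbar (Suc n)"
  using omega_w[of "Suc n"] by simp

lemma R_induct [case_names add mult const var]:
  fixes x :: R
  assumes "\<And>x y. Q x \<Longrightarrow> Q y \<Longrightarrow> Q (x + y)" "\<And>x y. Q x \<Longrightarrow> Q y \<Longrightarrow> Q (x * y)"
    and "\<And>c. Q (Const c)" "\<And>n. Q (Var n)"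
  shows "Q x"
proof -
  have one: "Q 1" and zero: "Q 0"
    using assms(3)[of 1] assms(3)[of 0] by simp_all
  have V: "Q (Poly_Mapping.single (Poly_Mapping.single v k) 1)" for v k
  proof (induction k)
    case (Suc k)
    have "Poly_Mapping.single (Poly_Mapping.single v (Suc k)) (1::bit)
      = Var v * Poly_Mapping.single (Poly_Mapping.single v k) 1"
      by (simp add: Var_def mult_single flip: single_add)
    with Suc show ?case
      by (simp add: assms)
  qed (simp add: one)
  have "Q (Poly_Mapping.single (\<Sum>v\<in>A. Poly_Mapping.single v (f v)) 1)" for A :: "nat set" and f
  proof (induction A rule: infinite_finite_induct)
    case (insert v A)
    then show ?case
      using assms(2)[OF V[of v "f v"] insert.IH] by (simp add: mult_single)
  qed (simp_all add: one)
  from this[of "Poly_Mapping.lookup m" "Poly_Mapping.keys m" for m]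
  have M: "Q (Poly_Mapping.single m 1)" for m
    by (simp add: poly_mapping_sum_single)
  have "Q (Poly_Mapping.single m a)" for m a
    using assms(2)[OF assms(3)[of a] M[of m]] by (cases "a = 0") (simp_all add: Const_def mult_single zero)
  then have "Q (\<Sum>m\<in>A. Poly_Mapping.single m (f m))" for A and f :: "_ \<Rightarrow> bit"
    by (induction A rule: infinite_finite_induct) (auto simp: assms zero)
  from this[of "Poly_Mapping.lookup x" "Poly_Mapping.keys x"] show ?thesis
    by (simp add: poly_mapping_sum_single)
qed

lemma omega_Const: "omega (Const c) = Const c"
  unfolding omega_def by (rule omega.mp_eval_Const)

lemma omega_omega [simp]: "omega (omega x) = x"
proof (induction x rule: R_induct)
  case (var n)
  show ?case by (simp only: omega_Var omega_wbar w.simps)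
qed (simp_all add: omega_add omega_mult omega_Const)

lemma d_0 [simp]: "d 0 = 0" and d_1 [simp]: "d 1 = 0"
  and d_add: "d (x + y) = d x + d y"
  by (simp_all add: d_def omega_add ac_simps)

text \<open>Compare omega (x y) with (x + dx) (y + dy). The extra term dx dy accounts for the
  products of symbols in both relations.\<close>

lemma d_mult: "d (x * y) = d x * y + x * d y + d x * d y"
  by (simp add: d_def omega_mult ring_distribs ac_simps)

lemma S_iff: "x \<in> S \<longleftrightarrow> d x = 0"
  unfolding S_def d_def mem_Collect_eq add_eq_0_iff_eq by (rule eq_commute)

lemma omega_S: "x \<in> S \<Longrightarrow> omega x = x"
  by (simp add: S_def)

lemma d_in_S: "d x \<in> S"
  by (simp add: S_def d_def omega_add add.commute)

lemma d_mult_S: "s \<in> S \<Longrightarrow> d (s * x) = s * d x"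
  by (simp add: S_iff d_mult)

lemma S_closed [simp]: "0 \<in> S" "1 \<in> S"
  "x \<in> S \<Longrightarrow> y \<in> S \<Longrightarrow> x + y \<in> S" "x \<in> S \<Longrightarrow> y \<in> S \<Longrightarrow> x * y \<in> S"
  by (simp_all add: S_def omega_add omega_mult)

lemma S_sum: "(\<And>i. i \<in> I \<Longrightarrow> f i \<in> S) \<Longrightarrow> sum f I \<in> S"
  by (simp add: S_def omega_sum)

lemma S_prod: "(\<And>i. i \<in> I \<Longrightarrow> f i \<in> S) \<Longrightarrow> prod f I \<in> S"
  by (simp add: S_def omega_prod)

lemma S_prod_mset: "(\<And>i. i \<in># I \<Longrightarrow> f i \<in> S) \<Longrightarrow> (\<Prod>i\<in>#I. f i) \<in> S"
  by (induction I) auto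

lemma psum_0 [simp]: "psum 0 = 0"
  by (subst psum.simps) simp

text \<open>Newton's identities in one equation: P is t times the logarithmic derivative of
  W.\<close>

lemma P_mult_W: "P_fps * W = fps_X * fps_deriv W"
proof (rule fps_ext)
  fix k show "fps_nth (P_fps * W) k = fps_nth (fps_X * fps_deriv W) k"
  proof (cases "k = 0")
    case False
    have "fps_nth (W * P_fps) k = (\<Sum>j=0..<k. psum (k - j) * w j)"
      using False by (simp add: fps_mult_nth sum.last_plus mult.commute)
    also have "\<dots> = of_nat k * w k"
      using False newton_identity[of k] by simp
    finally show ?thesis
      using False by (simp add: mult.commute)
  qed simp
qed

lemma P_eq: "P_fps = fps_X * fps_deriv W * Wbar"
  by (simp add: mult.assoc W_mult_Wbar flip: P_mult_W)

instance fps :: (char_two) char_two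
  by standard (rule fps_ext, simp add: numeral_fps_const)

text \<open>Since W Wbar = 1, the logarithmic derivatives of W and Wbar are opposite, hence equal in
  characteristic 2.\<close>

lemma fps_omega_P: "fps_omega P_fps = P_fps"
proof -
  have "fps_deriv W * Wbar + W * fps_deriv Wbar = 0"
    using arg_cong[OF W_mult_Wbar, of fps_deriv] by (simp add: add.commute)
  then have *: "fps_deriv W * Wbar = W * fps_deriv Wbar"
    by (simp add: add_eq_0_iff2)
  have "fps_omega (fps_X * fps_deriv W) = fps_X * fps_deriv Wbar"
    by (rule fps_ext) (auto simp: fps_omega_def omega_mult omega_w of_nat_even_odd)
  then have "fps_omega P_fps = fps_X * fps_deriv Wbar * W"
    unfolding P_eq fps_omega_mult by (simp add: fps_omega_Wbar)
  also have "\<dots> = P_fps"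
    unfolding P_eq mult.assoc * by (simp add: mult.commute)
  finally show ?thesis .
qed

lemma psum_in_S: "psum k \<in> S"
  using arg_cong[OF fps_omega_P, of "\<lambda>f. fps_nth f k"] by (cases "k = 0") (simp_all add: fps_omega_def S_def)

lemma fps_deriv_deriv: "fps_deriv (fps_deriv f) = (0 :: 'a::char_two fps)"
  by (rule fps_ext) (simp add: of_nat_even_odd flip: mult.assoc)

text \<open>Differentiating $P W = t W'$ gives $t P' + P^2 = P$, since $W'' = 0$ in characteristic 2.\<close>

lemma psum_square: "(psum k)\<^sup>2 = psum (2 * k)"
proof (cases "k = 0")
  case False
  have "fps_deriv P_fps * W + P_fps * fps_deriv W = fps_deriv W"
    using arg_cong[OF P_mult_W, of fps_deriv] by (simp add: fps_deriv_deriv ac_simps)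
  then have "fps_X * fps_deriv W = fps_X * fps_deriv P_fps * W + P_fps * (fps_X * fps_deriv W)"
    by (metis (no_types, lifting) distrib_left mult.assoc mult.left_commute)
  then have "P_fps * W = (fps_X * fps_deriv P_fps + P_fps * P_fps) * W"
    by (simp add: ring_distribs mult.assoc flip: P_mult_W)
  then have "P_fps * (W * Wbar) = (fps_X * fps_deriv P_fps + P_fps * P_fps) * (W * Wbar)"
    by (simp flip: mult.assoc)
  then have "P_fps = fps_X * fps_deriv P_fps + P_fps * P_fps"
    by (simp add: W_mult_Wbar)
  \<comment> \<open>The coefficient of t P' at the exponent 2k carries the factor 2k and drops
    out.\<close>
  from arg_cong[OF this, of "\<lambda>f. fps_nth f (2 * k)"]
  have "psum (2 * k) = fps_nth (P_fps * P_fps) (2 * k)"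
    using False by (simp add: of_nat_even_odd)
  also have "\<dots> = (\<Sum>i=0..2*k. fps_nth P_fps i * fps_nth P_fps (2 * k - i))"
    by (rule fps_mult_nth)
  also have "\<dots> = fps_nth P_fps k * fps_nth P_fps (2 * k - k)"
    by (rule sum_palindrome) (simp add: mult.commute)
  finally show ?thesis
    using False by (simp add: power2_eq_square)
qed simp

text \<open>This is relation (1) as it appears in S, since by \<open>d_mult\<close> the term u dv +
  du v equals d(uv) + du dv.\<close>

lemma psum_square_odd:
  assumes "odd k"
  shows "(psum k)\<^sup>2 = (\<Sum>j=0..(k-1) div 2. w (2*j) * d (w (2*(k-j))) + d (w (2*j)) * w (2*(k-j)))"
proof -
  have k: "k > 0" using assms by (rule odd_pos)
  let ?f = "\<lambda>j. w (2*j) * wbar (2*(k-j))"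
  let ?g = "\<lambda>i. w i * wbar (2 * k - i)"
  have ev: "{0..2*k} \<inter> {i. even i} = (*) 2 ` {0..k}"
    by (auto simp: image_iff elim!: evenE)
  have "psum (2 * k) = fps_nth (fps_X * fps_deriv W * Wbar) (2 * k)"
    using k by (simp flip: P_eq)
  also have "\<dots> = (\<Sum>i=0..2*k. of_nat i * ?g i)"
    unfolding fps_mult_nth[of "fps_X * fps_deriv W"] by (auto intro!: sum.cong simp: mult.assoc of_nat_even_odd)
  \<comment> \<open>The added sum is a coefficient of W Wbar = 1 and vanishes. It turns the sum over
    odd i into the sum over even i.\<close>
  also have "\<dots> = (\<Sum>i\<in>{0..2*k}. of_nat i * ?g i) + (\<Sum>i\<in>{0..2*k}. ?g i)"
    using wbar_recursion[of "2*k"] k by simp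
  also have "\<dots> = (\<Sum>i\<in>{0..2*k}. if even i then ?g i else 0)"
    by (auto simp flip: sum.distrib intro!: sum.cong simp: of_nat_even_odd)
  also have "\<dots> = (\<Sum>i\<in>(*) 2 ` {0..k}. ?g i)"
    by (simp add: sum.inter_restrict flip: ev)
  also have "\<dots> = (\<Sum>j\<in>{0..k}. ?f j)"
    by (subst sum.reindex) (auto simp: inj_on_def right_diff_distrib')
  also have "{0..k} = {0..(k-1) div 2} \<union> {Suc ((k-1) div 2)..k}"
    by auto
  also have "sum ?f \<dots> = sum ?f {0..(k-1) div 2} + sum ?f {Suc ((k-1) div 2)..k}"
    by (rule sum.union_disjoint) auto
  \<comment> \<open>Since k is odd, j -> k - j exchanges the two halves and fixes no index.\<close>
  also have "sum ?f {Suc ((k-1) div 2)..k} = (\<Sum>j=0..(k-1) div 2. wbar (2*j) * w (2*(k-j)))"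
    using assms by (intro sum.reindex_bij_witness[of _ "\<lambda>i. k - i" "\<lambda>i. k - i"])
      (auto simp: mult.commute elim!: oddE)
  also have "sum ?f {0..(k-1) div 2} + \<dots> = (\<Sum>j=0..(k-1) div 2. ?f j + wbar (2*j) * w (2*(k-j)))"
    by (simp add: sum.distrib)
  finally show ?thesis
    unfolding psum_square d_def omega_w by (simp add: ring_distribs ac_simps)
qed

section \<open>The standard form basis\<close>

definition wdeg :: "(nat \<Rightarrow>\<^sub>0 nat) \<Rightarrow> nat"
  where "wdeg m = (\<Sum>v\<in>Poly_Mapping.keys m. Suc v * Poly_Mapping.lookup m v)"

definition wlen :: "(nat \<Rightarrow>\<^sub>0 nat) \<Rightarrow> nat"
  where "wlen m = (\<Sum>v\<in>Poly_Mapping.keys m. Poly_Mapping.lookup m v)"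

lemma wdeg_add: "wdeg (m + n) = wdeg m + wdeg n"
  unfolding wdeg_def by (rule setsum_keys_plus_distrib) (auto simp: algebra_simps)

lemma wlen_add: "wlen (m + n) = wlen m + wlen n"
  unfolding wlen_def by (rule setsum_keys_plus_distrib) auto

lemma wdeg_0 [simp]: "wdeg 0 = 0" and wlen_0 [simp]: "wlen 0 = 0"
  and wdeg_single: "wdeg (Poly_Mapping.single v k) = Suc v * k"
  and wlen_single: "wlen (Poly_Mapping.single v k) = k"
  by (simp_all add: wdeg_def wlen_def)

lemma wlen_le_wdeg: "wlen m \<le> wdeg m"
  unfolding wdeg_def wlen_def by (intro sum_mono) simp

lemma wdeg_sum: "wdeg (\<Sum>i\<in>A. f i) = (\<Sum>i\<in>A. wdeg (f i))"
  by (induction A rule: infinite_finite_induct) (auto simp: wdeg_add)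

text \<open>Length is the filtration that isolates leading monomials. The upper bound on the degree
  also bounds the length, so successive corrections by longer terms come to an end.\<close>

definition filt :: "nat \<Rightarrow> nat \<Rightarrow> R set"
  where "filt n l = {f. \<forall>m\<in>Poly_Mapping.keys f. wdeg m \<le> n \<and> l \<le> wlen m}"

lemma filt_mono: "f \<in> filt n l \<Longrightarrow> n \<le> n' \<Longrightarrow> l' \<le> l \<Longrightarrow> f \<in> filt n' l'"
  unfolding filt_def by fastforce

lemma filt_0 [simp]: "0 \<in> filt n l"
  by (simp add: filt_def)

lemma filt_add: "f \<in> filt n l \<Longrightarrow> g \<in> filt n l \<Longrightarrow> f + g \<in> filt n l"
  using keys_add[of f g] unfolding filt_def by blast

lemma filt_cancel: "f + g \<in> filt n l \<Longrightarrow> g \<in> filt n l \<Longrightarrow> f \<in> filt n l"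
  using filt_add[of "f + g" n l g] by (simp add: add.assoc)

lemma filt_sum: "(\<And>i. i \<in> I \<Longrightarrow> f i \<in> filt n l) \<Longrightarrow> sum f I \<in> filt n l"
  by (induction I rule: infinite_finite_induct) (auto intro: filt_add)

lemma filt_mult:
  assumes "f \<in> filt n l" "g \<in> filt n' l'"
  shows "f * g \<in> filt (n + n') (l + l')"
proof -
  have "wdeg m \<le> n + n' \<and> l + l' \<le> wlen m" if m: "m \<in> Poly_Mapping.keys (f * g)" for m
  proof -
    obtain a b where "a \<in> Poly_Mapping.keys f" "b \<in> Poly_Mapping.keys g" "m = a + b"
      using m keys_mult[of f g] by blast
    then show ?thesis
      using assms by (simp add: filt_def wdeg_add wlen_add add_mono)
  qed
  then show ?thesis
    by (simp add: filt_def)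
qed

lemma filt_single: "wdeg m \<le> n \<Longrightarrow> l \<le> wlen m \<Longrightarrow> Poly_Mapping.single m c \<in> filt n l"
  by (cases "c = 0") (auto simp: filt_def)

lemma filt_1: "1 \<in> filt n 0"
  unfolding single_one[symmetric] by (rule filt_single) auto

lemma filt_w: "k \<ge> 1 \<Longrightarrow> w k \<in> filt k 1"
  by (cases k) (auto simp: Var_def wdeg_single wlen_single intro!: filt_single)

lemma filt_w0: "w k \<in> filt k 0"
  using filt_w[of k] filt_1[of 0] by (cases "k = 0") (auto intro: filt_mono)

text \<open>In the recursion for wbar, every term other than i = k is a product of two elements of
  positive index.\<close>

lemma filt_wbar: "k \<ge> 1 \<Longrightarrow> wbar k \<in> filt k 1 \<and> wbar k + w k \<in> filt k 2"
proof (induction k rule: less_induct)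
  case (less k)
  have "wbar k = (\<Sum>i\<in>{1..k}. w i * wbar (k - i))"
    using less.prems by (subst wbar.simps) simp
  also have "{1..k} = insert k {1..<k}"
    using less.prems by auto
  finally have eq: "wbar k + w k = (\<Sum>i\<in>{1..<k}. w i * wbar (k - i))"
    by (simp add: wbar_0 add.commute)
  have *: "\<dots> \<in> filt k 2"
  proof (rule filt_sum)
    fix i assume i: "i \<in> {1..<k}"
    then have "1 \<le> k - i" "k - i < k"
      by auto
    then show "w i * wbar (k - i) \<in> filt k 2"
      using i filt_mult[OF filt_w[of i] conjunct1[OF less.IH[of "k - i"]]] by (simp add: numeral_2_eq_2)
  qed
  then have "wbar k + w k \<in> filt k 1"
    unfolding eq by (rule filt_mono) auto
  then have "wbar k \<in> filt k 1"
    using filt_w[OF less.prems] by (rule filt_cancel)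
  then show ?case
    using * eq by simp
qed

text \<open>Modulo length 2 only the linear term k w_k of Newton's identity remains. It vanishes for
  even k, which is why the basis uses odd power sums. The bound on smaller indices is a hypothesis
  so that the lemma serves both inside the induction for \<open>filt_psum\<close> and after
  it.\<close>

lemma filt_psum_aux:
  assumes "k \<ge> 1" "\<And>j. j < k \<Longrightarrow> j \<ge> 1 \<Longrightarrow> psum j \<in> filt j 1"
  shows "psum k + of_nat k * w k \<in> filt k 2"
proof -
  have "psum k + of_nat k * w k = (\<Sum>j\<in>{1..<k}. psum (k - j) * w j)"
    by (subst psum.simps) (simp add: ac_simps)
  also have "\<dots> \<in> filt k 2"
  proof (rule filt_sum)
    fix j assume j: "j \<in> {1..<k}"
    then have "1 \<le> k - j" "k - j < k"
      by auto
    then show "psum (k - j) * w j \<in> filt k 2"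
      using j filt_mult[OF assms(2)[of "k - j"] filt_w[of j]] by (simp add: numeral_2_eq_2)
  qed
  finally show ?thesis .
qed

lemma filt_psum: "k \<ge> 1 \<Longrightarrow> psum k \<in> filt k 1"
proof (induction k rule: less_induct)
  case (less k)
  have "psum k + of_nat k * w k \<in> filt k 1"
    using filt_psum_aux[OF less.prems less.IH] by (rule filt_mono) auto
  moreover have "of_nat k * w k \<in> filt k 1"
    using filt_w[OF less.prems] by (simp add: of_nat_even_odd)
  ultimately show ?case
    by (rule filt_cancel)
qed

text \<open>The sum is a difference in characteristic 2: e is the only shortest monomial of f, and
  no term exceeds its degree.\<close>

definition lead :: "R \<Rightarrow> (nat \<Rightarrow>\<^sub>0 nat) \<Rightarrow> bool"
  where "lead f e \<longleftrightarrow> f + Poly_Mapping.single e 1 \<in> filt (wdeg e) (Suc (wlen e))"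

lemma lead_1: "lead 1 0"
  by (simp add: lead_def)

lemma lead_filt:
  assumes "lead f e" shows "f \<in> filt (wdeg e) (wlen e)"
proof (rule filt_cancel)
  show "f + Poly_Mapping.single e 1 \<in> filt (wdeg e) (wlen e)"
    using assms unfolding lead_def by (rule filt_mono) auto
qed (rule filt_single, auto)

lemma lead_mult:
  assumes "lead f e" "lead g e'"
  shows "lead (f * g) (e + e')"
proof -
  let ?m = "Poly_Mapping.single e (1::bit)" and ?m' = "Poly_Mapping.single e' (1::bit)"
  have "f * (g + ?m') + (f + ?m) * ?m' \<in> filt (wdeg e + wdeg e') (Suc (wlen e + wlen e'))"
  proof (rule filt_add)
    show "f * (g + ?m') \<in> filt (wdeg e + wdeg e') (Suc (wlen e + wlen e'))"
      using filt_mult[OF lead_filt[OF assms(1)]] assms(2) by (fastforce simp: lead_def)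
    show "(f + ?m) * ?m' \<in> filt (wdeg e + wdeg e') (Suc (wlen e + wlen e'))"
      using filt_mult[of "f + ?m" "wdeg e" "Suc (wlen e)" ?m' "wdeg e'" "wlen e'"] assms(1)
      by (simp add: lead_def filt_single)
  qed
  also have "f * (g + ?m') + (f + ?m) * ?m' = f * g + Poly_Mapping.single (e + e') 1"
    by (simp add: algebra_simps mult_single)
  finally show ?thesis
    by (simp add: lead_def wdeg_add wlen_add)
qed

lemma lead_prod: "(\<And>i. i \<in> A \<Longrightarrow> lead (f i) (e i)) \<Longrightarrow> lead (\<Prod>i\<in>A. f i) (\<Sum>i\<in>A. e i)"
  by (induction A rule: infinite_finite_induct) (auto simp: lead_1 intro: lead_mult)

lemma lead_prod_mset: "(\<And>i. i \<in># I \<Longrightarrow> lead (f i) (e i)) \<Longrightarrow> lead (\<Prod>i\<in>#I. f i) (\<Sum>i\<in>#I. e i)"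
  by (induction I) (auto simp: lead_1 intro: lead_mult)

lemma lead_psum: "i \<ge> 1 \<Longrightarrow> lead (psum (2 * i - 1)) (Poly_Mapping.single (2 * i - 2) 1)"
proof -
  assume i: "i \<ge> 1"
  obtain j where j: "i = Suc j" using i by (cases i) auto
  show ?thesis
    using filt_psum_aux[OF _ filt_psum, of "2 * i - 1"]
    by (simp add: j lead_def wdeg_single wlen_single of_nat_even_odd Var_def flip: numeral_2_eq_2)
qed

lemma lead_w: "i \<ge> 1 \<Longrightarrow> lead (w (2 * i)) (Poly_Mapping.single (2 * i - 1) 1)"
  by (cases i) (auto simp: lead_def Var_def)

text \<open>The recursion gives dw_{2i} as the sum of w_j wbar_{2i-j} for 0 < j < 2i. Replacing wbar
  by w costs terms of length at least 3, and the resulting palindromic sum collapses to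
  w_i^2.\<close>

lemma lead_dw:
  assumes "i \<ge> 1"
  shows "lead (d (w (2 * i))) (Poly_Mapping.single (i - 1) 2)"
proof -
  \<comment> \<open>The end terms are set to 0 so that the range is the symmetric one from 0 to
    2i.\<close>
  define g where "g = (\<lambda>j. if j \<in> {1..<2*i} then w j * w (2 * i - j) else 0)"
  have "wbar (2 * i) = (\<Sum>j\<in>{1..2*i}. w j * wbar (2 * i - j))"
    using assms by (subst wbar.simps) simp
  also have "{1..2*i} = insert (2*i) {1..<2*i}"
    using assms by auto
  finally have d: "d (w (2 * i)) = (\<Sum>j\<in>{1..<2*i}. w j * wbar (2 * i - j))"
    by (simp add: wbar_0 d_def omega_w)
  have "(\<Sum>j=0..2*i. g j) = g i"
    by (rule sum_palindrome) (auto simp: g_def mult.commute)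
  moreover have "(\<Sum>j=0..2*i. g j) = (\<Sum>j\<in>{1..<2*i}. w j * w (2 * i - j))"
    unfolding g_def by (simp add: sum.If_cases) (rule sum.cong, auto)
  moreover have "g i = Poly_Mapping.single (Poly_Mapping.single (i - 1) 2) 1"
    using assms by (cases i) (auto simp: g_def Var_def mult_single numeral_2_eq_2 simp flip: single_add)
  ultimately have "d (w (2 * i)) + Poly_Mapping.single (Poly_Mapping.single (i - 1) 2) 1
    = (\<Sum>j\<in>{1..<2*i}. w j * (wbar (2 * i - j) + w (2 * i - j)))"
    by (simp add: d distrib_left sum.distrib)
  also have "\<dots> \<in> filt (2 * i) 3"
  proof (rule filt_sum)
    fix j assume j: "j \<in> {1..<2*i}"
    then have "1 \<le> 2 * i - j"
      by auto
    then show "w j * (wbar (2 * i - j) + w (2 * i - j)) \<in> filt (2 * i) 3"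
      using j filt_mult[OF filt_w[of j] conjunct2[OF filt_wbar[of "2 * i - j"]]] by (simp add: eval_nat_numeral)
  qed
  finally show ?thesis
    using assms by (simp add: lead_def wdeg_single wlen_single eval_nat_numeral)
qed

text \<open>Variable v is w_{v+1}, hence the shifts: the three sums record the leading monomials
  w_{2i-1} of p_{2i-1}, w_{2i} of itself, and w_i^2 of dw_{2i}.\<close>

definition expo :: "std_index \<Rightarrow> (nat \<Rightarrow>\<^sub>0 nat)"
  where "expo = (\<lambda>(P, A, I). (\<Sum>i\<in>P. Poly_Mapping.single (2 * i - 2) 1)
    + (\<Sum>i\<in>A. Poly_Mapping.single (2 * i - 1) 1) + (\<Sum>i\<in>#I. Poly_Mapping.single (i - 1) 2))"

lemma lead_std_elt: "t \<in> std_indices \<Longrightarrow> lead (std_elt t) (expo t)"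
proof -
  assume "t \<in> std_indices"
  moreover obtain P A I where t: "t = (P, A, I)"
    by (rule prod_cases3)
  ultimately have "\<And>i. i \<in> P \<Longrightarrow> i \<ge> 1" "\<And>i. i \<in> A \<Longrightarrow> i \<ge> 1" "\<And>i. i \<in># I \<Longrightarrow> i \<ge> 1"
    unfolding std_indices_def by auto
  then show ?thesis
    unfolding t std_elt_def expo_def sqf_even_def prod.case
    by (intro lead_mult lead_prod lead_prod_mset lead_psum lead_w lead_dw)
qed

text \<open>Division of an exponent by 2 recovers the index: the remainder decides membership in P
  or in A, according to the parity of the variable, and the quotient is a multiplicity in I. Both
  injectivity and surjectivity of \<open>expo\<close> rest on this.\<close>

lemma lookup_expo:
  assumes "(P, A, I) \<in> std_indices"
  shows "Poly_Mapping.lookup (expo (P, A, I)) j =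
    (if even j then of_bool (Suc (j div 2) \<in> P) else of_bool (Suc (j div 2) \<in> A)) + 2 * count I (Suc j)"
proof -
  have PA: "finite P" "P \<subseteq> {1..}" "finite A" "A \<subseteq> {1..}" and I: "set_mset I \<subseteq> {1..}"
    using assms by (auto simp: std_indices_def)
  have "Poly_Mapping.lookup (\<Sum>i\<in>P. Poly_Mapping.single (2 * i - 2) (1::nat)) j =
    (\<Sum>i\<in>P. if even j \<and> i = Suc (j div 2) then 1 else 0)"
    unfolding lookup_sum using PA by (intro sum.cong) (auto simp: lookup_single when_def)
  also have "\<dots> = of_bool (even j \<and> Suc (j div 2) \<in> P)"
    using PA by (cases "even j") auto
  finally have 1: "Poly_Mapping.lookup (\<Sum>i\<in>P. Poly_Mapping.single (2 * i - 2) (1::nat)) j = \<dots>" .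
  have "Poly_Mapping.lookup (\<Sum>i\<in>A. Poly_Mapping.single (2 * i - 1) (1::nat)) j =
    (\<Sum>i\<in>A. if odd j \<and> i = Suc (j div 2) then 1 else 0)"
    unfolding lookup_sum using PA by (intro sum.cong) (auto simp: lookup_single when_def elim!: oddE)
  also have "\<dots> = of_bool (odd j \<and> Suc (j div 2) \<in> A)"
    using PA by (cases "even j") auto
  finally have 2: "Poly_Mapping.lookup (\<Sum>i\<in>A. Poly_Mapping.single (2 * i - 1) (1::nat)) j = \<dots>" .
  have 3: "Poly_Mapping.lookup (\<Sum>i\<in>#I. Poly_Mapping.single (i - 1) (2::nat)) j = 2 * count I (Suc j)"
    using I by (induction I) (auto simp: lookup_add lookup_single when_def)
  show ?thesis
    unfolding expo_def prod.case lookup_add 1 2 3 by simp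
qed

lemma inj_on_expo: "inj_on expo std_indices"
proof (rule inj_onI)
  fix s s' :: std_index
  assume "s \<in> std_indices" "s' \<in> std_indices" "expo s = expo s'"
  moreover obtain P A I P' A' I' where s: "s = (P, A, I)" "s' = (P', A', I')"
    by (metis prod_cases3)
  ultimately have t: "(P, A, I) \<in> std_indices" and t': "(P', A', I') \<in> std_indices"
    and eq: "expo (P, A, I) = expo (P', A', I')"
    by auto
  have pos: "P \<subseteq> {1..}" "A \<subseteq> {1..}" "P' \<subseteq> {1..}" "A' \<subseteq> {1..}" "set_mset I \<subseteq> {1..}" "set_mset I' \<subseteq> {1..}"
    using t t' by (auto simp: std_indices_def)
  have *: "(if even j then of_bool (Suc (j div 2) \<in> P) else of_bool (Suc (j div 2) \<in> A)) + 2 * count I (Suc j)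
    = (if even j then of_bool (Suc (j div 2) \<in> P') else of_bool (Suc (j div 2) \<in> A')) + 2 * count I' (Suc j)"
    for j
    using eq lookup_expo[OF t, of j] lookup_expo[OF t', of j] by simp
  have of_bool_eq: "of_bool a + 2 * m = of_bool b + 2 * n \<longleftrightarrow> a = b \<and> m = n" for a b and m n :: nat
    by (cases a; cases b; simp; presburger)
  have P: "Suc j \<in> P \<longleftrightarrow> Suc j \<in> P'" for j
    using *[of "2 * j"] by (simp add: of_bool_eq)
  have A: "Suc j \<in> A \<longleftrightarrow> Suc j \<in> A'" for j
    using *[of "Suc (2 * j)"] by (simp add: of_bool_eq)
  have I: "count I (Suc j) = count I' (Suc j)" for j
    using *[of j] by (simp add: of_bool_eq split: if_splits)
  have pos': "x \<in> X \<Longrightarrow> \<exists>j. x = Suc j" if "X \<subseteq> {1..}" for X x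
    using that by (cases x) auto
  have "x \<in> P \<longleftrightarrow> x \<in> P'" "x \<in> A \<longleftrightarrow> x \<in> A'" for x
    using P A pos by (cases x; force)+
  moreover have "count I x = count I' x" for x
  proof (cases x)
    case 0
    then have "x \<notin># I" "x \<notin># I'" using pos by auto
    then show ?thesis by (metis count_eq_zero_iff)
  qed (simp add: I)
  ultimately show "s = s'"
    unfolding s by (auto intro!: multiset_eqI)
qed

lemma expo_surj: "\<exists>t\<in>std_indices. expo t = e"
proof -
  define P where "P = {i. i \<ge> 1 \<and> odd (Poly_Mapping.lookup e (2 * i - 2))}"
  define A where "A = {i. i \<ge> 1 \<and> odd (Poly_Mapping.lookup e (2 * i - 1))}"
  define I where "I = (\<Sum>v\<in>Poly_Mapping.keys e. replicate_mset (Poly_Mapping.lookup e v div 2) (Suc v))"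
  have odd_keys: "v \<in> Poly_Mapping.keys e" if "odd (Poly_Mapping.lookup e v)" for v
    using that by (metis even_zero in_keys_iff)
  have "P \<subseteq> (\<lambda>v. Suc (v div 2)) ` Poly_Mapping.keys e"
  proof
    fix i assume "i \<in> P"
    then show "i \<in> (\<lambda>v. Suc (v div 2)) ` Poly_Mapping.keys e"
      using odd_keys by (intro image_eqI[of _ _ "2 * i - 2"]) (auto simp: P_def)
  qed
  then have "finite P"
    by (rule finite_subset) auto
  have "A \<subseteq> (\<lambda>v. Suc (v div 2)) ` Poly_Mapping.keys e"
  proof
    fix i assume "i \<in> A"
    then show "i \<in> (\<lambda>v. Suc (v div 2)) ` Poly_Mapping.keys e"
      using odd_keys by (intro image_eqI[of _ _ "2 * i - 1"]) (auto simp: A_def)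
  qed
  then have "finite A"
    by (rule finite_subset) auto
  have cI: "count I (Suc j) = Poly_Mapping.lookup e j div 2" for j
    unfolding I_def count_sum by (simp add: in_keys_iff)
  have "set_mset I \<subseteq> {1..}"
    unfolding I_def by (subst set_mset_sum) auto
  then have t: "(P, A, I) \<in> std_indices"
    using \<open>finite P\<close> \<open>finite A\<close> by (auto simp: std_indices_def P_def A_def)
  have "expo (P, A, I) = e"
  proof (rule poly_mapping_eqI)
    fix j
    have "2 * (j div 2) = j" if "even j" for j :: nat using that by simp
    moreover have "Suc (2 * (j div 2)) = j" if "odd j" for j using that by simp
    ultimately show "Poly_Mapping.lookup (expo (P, A, I)) j = Poly_Mapping.lookup e j"
      unfolding lookup_expo[OF t] cI by (auto simp: P_def A_def of_bool_def; presburger)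
  qed
  with t show ?thesis by blast
qed

section \<open>The standard elements form a basis\<close>

lemma std_elt_independent:
  assumes "finite T" "T \<subseteq> std_indices" "(\<Sum>t\<in>T. std_elt t) = 0"
  shows "T = {}"
proof (rule ccontr)
  assume "T \<noteq> {}"
  \<comment> \<open>For s with the shortest leading monomial, \<open>expo s\<close> occurs in no
    correction term, as those are strictly longer. So its coefficient in the sum comes from s
    alone.\<close>
  obtain s where s: "s \<in> T" "\<And>t. t \<in> T \<Longrightarrow> wlen (expo s) \<le> wlen (expo t)"
    using ex_min_if_finite[of "(\<lambda>t. wlen (expo t)) ` T"] assms(1) \<open>T \<noteq> {}\<close>
    by (metis (no_types, lifting) finite_imageI image_is_empty arg_min_if_finite(1) arg_min_least)
  have "Poly_Mapping.lookup (std_elt t) (expo s) = (if t = s then 1 else 0)" if "t \<in> T" for t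
  proof -
    have "std_elt t + Poly_Mapping.single (expo t) 1 \<in> filt (wdeg (expo t)) (Suc (wlen (expo t)))"
      using lead_std_elt[of t] that assms(2) by (auto simp: lead_def)
    then have "expo s \<notin> Poly_Mapping.keys (std_elt t + Poly_Mapping.single (expo t) 1)"
      using s(2)[OF that] by (auto simp: filt_def)
    then have "Poly_Mapping.lookup (std_elt t) (expo s) + (1 when expo t = expo s) = 0"
      by (simp add: in_keys_iff lookup_add lookup_single)
    then have "Poly_Mapping.lookup (std_elt t) (expo s) = (1 when expo t = expo s)"
      unfolding add_eq_0_iff_eq .
    moreover have "expo t = expo s \<longleftrightarrow> t = s"
      using inj_on_expo that s(1) assms(2) by (auto dest: inj_onD)
    ultimately show ?thesis
      by (simp add: when_def)
  qed
  then have "Poly_Mapping.lookup (\<Sum>t\<in>T. std_elt t) (expo s) = 1"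
    using s(1) assms(1) by (simp add: lookup_sum)
  then show False
    using assms(3) by simp
qed

text \<open>The degree bound is carried along because the later induction on degree needs expansions
  that do not raise the degree.\<close>

definition std_span :: "nat \<Rightarrow> R set"
  where "std_span n = {\<Sum>t\<in>T. std_elt t |T. finite T \<and> T \<subseteq> std_indices \<and> (\<forall>t\<in>T. wdeg (expo t) \<le> n)}"

lemma std_span_0: "0 \<in> std_span n"
  unfolding std_span_def by (auto intro!: exI[of _ "{}"])

lemma std_span_add: "x \<in> std_span n \<Longrightarrow> y \<in> std_span n \<Longrightarrow> x + y \<in> std_span n"
proof -
  assume "x \<in> std_span n" "y \<in> std_span n"
  then obtain T U where
    T: "finite T" "T \<subseteq> std_indices" "\<forall>t\<in>T. wdeg (expo t) \<le> n" "x = (\<Sum>t\<in>T. std_elt t)" and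
    U: "finite U" "U \<subseteq> std_indices" "\<forall>t\<in>U. wdeg (expo t) \<le> n" "y = (\<Sum>t\<in>U. std_elt t)"
    unfolding std_span_def by blast
  have "x + y = (\<Sum>t\<in>sym_diff T U. std_elt t)"
    using T U by (simp add: sum_sym_diff)
  then show ?thesis
    using T U unfolding std_span_def by (intro CollectI exI[of _ "sym_diff T U"]) auto
qed

lemma std_span_sum: "(\<And>i. i \<in> I \<Longrightarrow> f i \<in> std_span n) \<Longrightarrow> sum f I \<in> std_span n"
  by (induction I rule: infinite_finite_induct) (auto intro: std_span_add std_span_0)

text \<open>Subtracting the standard element with this leading monomial leaves longer monomials of
  no larger degree. Length is at most degree, so n - \<open>wlen e\<close> decreases.\<close>

lemma single_in_std_span: "wdeg e \<le> n \<Longrightarrow> Poly_Mapping.single e 1 \<in> std_span n"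
proof (induction "n - wlen e" arbitrary: e rule: less_induct)
  case less
  obtain t where t: "t \<in> std_indices" "expo t = e"
    using expo_surj by blast
  define r where "r = std_elt t + Poly_Mapping.single e 1"
  have r: "r \<in> filt (wdeg e) (Suc (wlen e))"
    using lead_std_elt[OF t(1)] t(2) by (simp add: lead_def r_def)
  have "Poly_Mapping.single m (Poly_Mapping.lookup r m) \<in> std_span n" if "m \<in> Poly_Mapping.keys r" for m
  proof -
    have m: "wdeg m \<le> wdeg e" "wlen e < wlen m"
      using r that by (auto simp: filt_def)
    then have "n - wlen m < n - wlen e"
      using less.prems wlen_le_wdeg[of m] by linarith
    then have "Poly_Mapping.single m 1 \<in> std_span n"
      using m less.prems by (intro less.hyps) auto
    then show ?thesis
      using that by (simp add: in_keys_iff)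
  qed
  then have "r \<in> std_span n"
    using std_span_sum poly_mapping_sum_single by metis
  moreover have "std_elt t \<in> std_span n"
    unfolding std_span_def using t less.prems by (intro CollectI exI[of _ "{t}"]) auto
  ultimately have "r + std_elt t \<in> std_span n"
    by (rule std_span_add)
  then show ?case
    by (simp add: r_def ac_simps)
qed

lemma filt_in_std_span: "x \<in> filt n l \<Longrightarrow> x \<in> std_span n"
proof -
  assume x: "x \<in> filt n l"
  have "(\<Sum>m\<in>Poly_Mapping.keys x. Poly_Mapping.single m (Poly_Mapping.lookup x m)) \<in> std_span n"
  proof (rule std_span_sum)
    fix m assume m: "m \<in> Poly_Mapping.keys x"
    then have "Poly_Mapping.single m 1 \<in> std_span n"
      using x by (intro single_in_std_span) (auto simp: filt_def)
    then show "Poly_Mapping.single m (Poly_Mapping.lookup x m) \<in> std_span n"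
      using m by (simp add: in_keys_iff)
  qed
  then show ?thesis
    by (simp add: poly_mapping_sum_single)
qed

lemma in_filt: "\<exists>n. x \<in> filt n 0"
  unfolding filt_def by (auto intro!: exI[of _ "Max (wdeg ` Poly_Mapping.keys x)"])

lemma std_expansion_unique:
  assumes "finite T" "T \<subseteq> std_indices" "(\<Sum>t\<in>T. std_elt t) = x"
  shows "std_expansion x = T"
  unfolding std_expansion_def
proof (rule the_equality)
  fix U assume U: "finite U \<and> U \<subseteq> std_indices \<and> (\<Sum>t\<in>U. std_elt t) = x"
  have "sym_diff T U = {}"
    using assms U by (intro std_elt_independent) (auto simp: sum_sym_diff)
  then show "U = T" by blast
qed (use assms in auto)

lemma std_expansion_filt:
  assumes "x \<in> filt n l"
  shows "finite (std_expansion x)" "std_expansion x \<subseteq> std_indices" "(\<Sum>t\<in>std_expansion x. std_elt t) = x"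
    "\<And>t. t \<in> std_expansion x \<Longrightarrow> wdeg (expo t) \<le> n"
proof -
  obtain T where T: "finite T" "T \<subseteq> std_indices" "\<forall>t\<in>T. wdeg (expo t) \<le> n" "(\<Sum>t\<in>T. std_elt t) = x"
    using filt_in_std_span[OF assms] unfolding std_span_def by blast
  have "std_expansion x = T"
    using T by (intro std_expansion_unique)
  then show "finite (std_expansion x)" "std_expansion x \<subseteq> std_indices" "(\<Sum>t\<in>std_expansion x. std_elt t) = x"
    "\<And>t. t \<in> std_expansion x \<Longrightarrow> wdeg (expo t) \<le> n"
    using T by auto
qed

lemma std_expansion:
  "finite (std_expansion x)" "std_expansion x \<subseteq> std_indices" "(\<Sum>t\<in>std_expansion x. std_elt t) = x"
  using in_filt[of x] std_expansion_filt(1-3) by blast+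

lemma std_induct [case_names zero add std]:
  assumes "Q 0" "\<And>x y. Q x \<Longrightarrow> Q y \<Longrightarrow> Q (x + y)" "\<And>t. t \<in> std_indices \<Longrightarrow> Q (std_elt t)"
  shows "Q x"
proof -
  have "Q (\<Sum>t\<in>T. std_elt t)" if "T \<subseteq> std_indices" for T
    using that by (induction T rule: infinite_finite_induct) (auto simp: assms)
  from this[OF std_expansion(2)] show ?thesis
    by (simp add: std_expansion(3))
qed

text \<open>Linear extension from the basis; \<open>eps\<close>, \<open>htpy\<close> and
  \<open>delta\<close> all have this shape. Characteristic 2 in the target matches symmetric
  difference of expansions.\<close>

definition std_lin :: "(std_index \<Rightarrow> 'b::char_two) \<Rightarrow> R \<Rightarrow> 'b"
  where "std_lin g x = (\<Sum>t\<in>std_expansion x. g t)"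

lemma std_lin_add: "std_lin g (x + y) = std_lin g x + std_lin g y"
proof -
  have "std_expansion (x + y) = sym_diff (std_expansion x) (std_expansion y)"
    using std_expansion[of x] std_expansion[of y]
    by (intro std_expansion_unique) (auto simp: sum_sym_diff)
  then show ?thesis
    by (simp add: std_lin_def sum_sym_diff std_expansion(1))
qed

lemma std_lin_0 [simp]: "std_lin g 0 = 0"
  using std_lin_add[of g 0 0] by simp

lemma std_lin_sum: "std_lin g (\<Sum>i\<in>I. f i) = (\<Sum>i\<in>I. std_lin g (f i))"
  by (induction I rule: infinite_finite_induct) (auto simp: std_lin_add)

lemma std_lin_std_elt: "t \<in> std_indices \<Longrightarrow> std_lin g (std_elt t) = g t"
  unfolding std_lin_def by (subst std_expansion_unique[of "{t}"]) auto

section \<open>The contracting homotopy\<close>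

abbreviation pprod :: "nat set \<Rightarrow> R" where "pprod P \<equiv> \<Prod>i\<in>P. psum (2 * i - 1)"
abbreviation yprod :: "nat multiset \<Rightarrow> R" where "yprod I \<equiv> \<Prod>i\<in>#I. d (w (2 * i))"

lemma std_indices_iff:
  "(P, A, I) \<in> std_indices \<longleftrightarrow>
    finite P \<and> P \<subseteq> {1..} \<and> finite A \<and> A \<subseteq> {1..} \<and> set_mset I \<subseteq> {1..}"
  by (simp add: std_indices_def)

lemma std_elt_eq: "std_elt (P, A, I) = pprod P * sqf_even A * yprod I"
  by (simp add: std_elt_def)

lemma sqf_even_empty [simp]: "sqf_even {} = 1"
  by (simp add: sqf_even_def)

lemma sqf_even_singleton: "sqf_even {i} = w (2 * i)"
  by (simp add: sqf_even_def)

lemma sqf_even_union: "finite A \<Longrightarrow> finite B \<Longrightarrow> A \<inter> B = {} \<Longrightarrow> sqf_even (A \<union> B) = sqf_even A * sqf_even B"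
  unfolding sqf_even_def by (rule prod.union_disjoint)

text \<open>Power sums and the dw_{2i} are invariant, and each w_{2i} goes to w_{2i} + dw_{2i}.
  Multiplying out, B is the set of factors kept. All terms are again standard, which makes
  \<open>omega\<close> and \<open>d\<close> explicit on the basis.\<close>

lemma omega_std_elt:
  assumes "finite A"
  shows "omega (std_elt (P, A, I)) = (\<Sum>B\<in>Pow A. std_elt (P, B, I + mset_set (A - B)))"
proof -
  have "omega (w k) = w k + d (w k)" for k
    by (simp add: d_def)
  then have "omega (sqf_even A) = (\<Sum>B\<in>Pow A. sqf_even B * yprod (mset_set (A - B)))"
    unfolding sqf_even_def omega_prod prod_unfold_prod_mset[symmetric] using assms
    by (simp add: prod_add)
  then show ?thesis
    by (simp add: std_elt_eq omega_mult omega_S S_prod S_prod_mset psum_in_S d_in_S sum_distrib_left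
      sum_distrib_right ac_simps)
qed

lemma d_std_elt:
  assumes "finite A"
  shows "d (std_elt (P, A, I)) = (\<Sum>B\<in>Pow A - {A}. std_elt (P, B, I + mset_set (A - B)))"
proof -
  have "omega (std_elt (P, A, I)) = std_elt (P, A, I) + (\<Sum>B\<in>Pow A - {A}. std_elt (P, B, I + mset_set (A - B)))"
    unfolding omega_std_elt[OF assms] using assms by (subst sum.remove[of _ A]) auto
  then show ?thesis
    by (simp add: d_def)
qed

definition eps :: "R \<Rightarrow> R"
  where "eps = std_lin (\<lambda>(P, A, I). if A = {} \<and> I = {#} then pprod P else 0)"

text \<open>On the tensor factor $\mathbb{F}_2[y]\{1,u\}$ with $\overline u = u + y$ a contraction is
  $y^{k+1} \mapsto y^k u$, $y^k u \mapsto 0$; the map \<open>htpy\<close> is the usual extension to a tensor product,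
  applied to the first nontrivial factor.\<close>

definition htpy :: "R \<Rightarrow> R"
  where "htpy = std_lin (\<lambda>(P, A, I). let M = A \<union> set_mset I; i = Min M in
    if M = {} \<or> i \<in> A then 0 else w (2 * i) * omega (std_elt (P, A, I - {#i#})))"

lemma eps_0 [simp]: "eps 0 = 0" and htpy_0 [simp]: "htpy 0 = 0"
  and eps_add: "eps (x + y) = eps x + eps y" and htpy_add: "htpy (x + y) = htpy x + htpy y"
  and eps_sum: "eps (\<Sum>i\<in>K. f i) = (\<Sum>i\<in>K. eps (f i))"
  and htpy_sum: "htpy (\<Sum>i\<in>K. f i) = (\<Sum>i\<in>K. htpy (f i))"
  by (simp_all add: eps_def htpy_def std_lin_add std_lin_sum)

lemma eps_std_elt:
  "(P, A, I) \<in> std_indices \<Longrightarrow> eps (std_elt (P, A, I)) = (if A = {} \<and> I = {#} then pprod P else 0)"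
  by (simp add: eps_def std_lin_std_elt)

lemma htpy_std_elt:
  "(P, A, I) \<in> std_indices \<Longrightarrow> htpy (std_elt (P, A, I)) = (let M = A \<union> set_mset I; i = Min M in
    if M = {} \<or> i \<in> A then 0 else w (2 * i) * omega (std_elt (P, A, I - {#i#})))"
  by (simp add: htpy_def std_lin_std_elt)

lemma std_indices_Pow:
  "(P, A, I) \<in> std_indices \<Longrightarrow> B \<in> Pow A \<Longrightarrow> (P, B, I + mset_set (A - B)) \<in> std_indices"
  unfolding std_indices_iff using finite_subset[of B A] by auto

lemma std_induct3 [case_names zero add std]:
  assumes "Q 0" "\<And>x y. Q x \<Longrightarrow> Q y \<Longrightarrow> Q (x + y)"
    "\<And>P A I. (P, A, I) \<in> std_indices \<Longrightarrow> Q (std_elt (P, A, I))"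
  shows "Q x"
  by (induction x rule: std_induct) (use assms in auto)

text \<open>Every term of d of a basis element has dropped some index from A and thus contains a
  factor \<open>d (w (2 * i))\<close>, which \<open>eps\<close> kills.\<close>

lemma eps_d: "eps (d x) = 0"
proof (induction x rule: std_induct3)
  case (std P A I)
  have "eps (d (std_elt (P, A, I))) = (\<Sum>B\<in>Pow A - {A}. eps (std_elt (P, B, I + mset_set (A - B))))"
    using std by (simp add: d_std_elt std_indices_iff eps_sum)
  also have "\<dots> = 0"
  proof (rule sum.neutral, rule ballI)
    fix B assume B: "B \<in> Pow A - {A}"
    then have "mset_set (A - B) \<noteq> {#}"
      using std by (auto simp: std_indices_iff mset_set_empty_iff)
    then show "eps (std_elt (P, B, I + mset_set (A - B))) = 0"
      using std_indices_Pow[OF std] B by (subst eps_std_elt) auto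
  qed
  finally show ?case .
qed (simp_all add: d_add eps_add)

lemma eps_pprod:
  assumes "finite P" "P \<subseteq> {1..}"
  shows "eps (pprod P) = pprod P" "htpy (pprod P) = 0"
  using eps_std_elt[of P "{}" "{#}"] htpy_std_elt[of P "{}" "{#}"] assms
  by (simp_all add: std_elt_eq std_indices_iff)

lemma htpy_eps: "htpy (eps x) = 0"
proof (induction x rule: std_induct3)
  case (std P A I)
  then show ?case
    by (simp add: eps_std_elt eps_pprod std_indices_iff del: One_nat_def)
qed (simp_all add: eps_add htpy_add)

text \<open>An index dropped from A reappears in the multiset, so all terms of omega x have the same
  support as x, and \<open>htpy\<close> acts on all of them through the same smallest index i. If i
  lies in A, only the terms where i was dropped survive, and they reassemble to
  \<open>w (2 * i)\<close> times a twofold \<open>omega\<close>.\<close>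

lemma homotopy: "d (htpy x) + htpy (d x) = x + eps x"
proof (induction x rule: std_induct3)
  case (add x y)
  have "d (htpy (x + y)) + htpy (d (x + y)) = (d (htpy x) + htpy (d x)) + (d (htpy y) + htpy (d y))"
    by (simp add: d_add htpy_add ac_simps)
  then show ?case
    unfolding add by (simp add: eps_add ac_simps)
next
  case (std P A I)
  note fin = std[unfolded std_indices_iff]
  let ?x = "std_elt (P, A, I)"
  define M where "M = A \<union> set_mset I"
  show ?case
  proof (cases "M = {}")
    case True
    then have "A = {}" "I = {#}"
      by (auto simp: M_def)
    then show ?thesis
      using std d_std_elt[of "{}" P "{#}"] by (simp add: htpy_std_elt eps_std_elt) (simp add: std_elt_eq)
  next
    case False
    define i where "i = Min M"
    have "finite M"
      using fin by (simp add: M_def)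
    then have i: "i \<in> M"
      using False by (simp add: i_def)
    have eps: "eps ?x = 0"
      using False std by (auto simp: eps_std_elt M_def)
    have htpyB: "htpy (std_elt (P, B, I + mset_set (A - B))) =
        (if i \<in> B then 0 else w (2 * i) * omega (std_elt (P, B, I + mset_set (A - B) - {#i#})))"
      if "B \<in> Pow A" for B
    proof -
      have "B \<union> set_mset (I + mset_set (A - B)) = M"
        using that fin by (auto simp: M_def)
      then show ?thesis
        using htpy_std_elt[OF std_indices_Pow[OF std that]] False by (simp add: Let_def i_def)
    qed
    have hd: "htpy (d ?x) = htpy ?x + (\<Sum>B\<in>Pow A. htpy (std_elt (P, B, I + mset_set (A - B))))"
      using fin by (simp add: d_def htpy_add omega_std_elt htpy_sum)
    show ?thesis
    proof (cases "i \<in> A")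
      case True
      let ?A = "A - {i}"
      have "htpy ?x = 0"
        using True False std by (simp add: htpy_std_elt Let_def flip: i_def M_def)
      then have "htpy (d ?x) = (\<Sum>B\<in>Pow A. if i \<in> B then 0 else
          w (2 * i) * omega (std_elt (P, B, I + mset_set (A - B) - {#i#})))"
        unfolding hd by (simp add: htpyB)
      also have "\<dots> = (\<Sum>B\<in>Pow ?A. w (2 * i) * omega (std_elt (P, B, I + mset_set (A - B) - {#i#})))"
        using fin by (intro sum.mono_neutral_cong_right) auto
      also have "\<dots> = (\<Sum>B\<in>Pow ?A. w (2 * i) * omega (std_elt (P, B, I + mset_set (?A - B))))"
      proof (rule sum.cong[OF refl])
        fix B assume "B \<in> Pow ?A"
        then have "A - B = insert i (?A - B)"
          using True by auto
        then have "mset_set (A - B) = add_mset i (mset_set (?A - B))"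
          using fin by (metis Diff_iff finite_Diff mset_set.insert singletonI)
        then show "w (2 * i) * omega (std_elt (P, B, I + mset_set (A - B) - {#i#})) =
            w (2 * i) * omega (std_elt (P, B, I + mset_set (?A - B)))"
          by simp
      qed
      also have "\<dots> = w (2 * i) * omega (omega (std_elt (P, ?A, I)))"
        using fin by (simp add: omega_std_elt omega_sum sum_distrib_left)
      also have "\<dots> = ?x"
        using True fin by (simp add: std_elt_eq sqf_even_def prod.remove[of A i] ac_simps)
      finally show ?thesis
        using \<open>htpy ?x = 0\<close> eps by simp
    next
      case iA: False
      then have iI: "i \<in># I"
        using i by (simp add: M_def)
      define y where "y = std_elt (P, A, I - {#i#})"
      have x: "?x = d (w (2 * i)) * y"
        using iI by (auto simp: y_def std_elt_eq ac_simps dest!: multi_member_split)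
      have hx: "htpy ?x = w (2 * i) * omega y"
        using iA False std by (simp add: htpy_std_elt Let_def y_def flip: i_def M_def)
      have "(\<Sum>B\<in>Pow A. htpy (std_elt (P, B, I + mset_set (A - B)))) =
          (\<Sum>B\<in>Pow A. w (2 * i) * omega (std_elt (P, B, (I - {#i#}) + mset_set (A - B))))"
        using iA iI by (intro sum.cong) (auto simp: htpyB multiset_diff_union_assoc ac_simps)
      also have "\<dots> = w (2 * i) * omega (omega y)"
        unfolding y_def using fin by (simp only: omega_std_elt omega_sum sum_distrib_left)
      finally have "htpy (d ?x) = w (2 * i) * omega y + w (2 * i) * y"
        unfolding hd hx by simp
      \<comment> \<open>With u = w_{2i} and x = du y, the \<open>omega\<close> in
        \<open>htpy\<close> makes d(u omega(y)) = u dy + du y. The first term cancels against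
        htpy(dx) = u dy and the second is x.\<close>
      then show ?thesis
        unfolding hx eps by (simp add: d_def omega_mult x ring_distribs ac_simps)
    qed
  qed
qed simp

section \<open>The ring of power sums and the splitting of the invariants\<close>

lemma PS_psum: "k \<ge> 1 \<Longrightarrow> psum k \<in> PS"
  unfolding PS_def by (rule generate_ring.incl) auto

lemma PS_prod: "(\<And>i. i \<in> A \<Longrightarrow> f i \<in> PS) \<Longrightarrow> prod f A \<in> PS"
  by (induction A rule: infinite_finite_induct) (auto intro: PS_one PS_mult)

lemma PS_pprod: "P \<subseteq> {1..} \<Longrightarrow> pprod P \<in> PS"
  by (rule PS_prod, rule PS_psum) force

lemma eps_in_PS: "eps x \<in> PS"
proof (induction x rule: std_induct3)
  case (std P A I)
  then show ?case
    by (simp add: eps_std_elt std_indices_iff PS_zero PS_pprod del: One_nat_def)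
qed (simp_all add: eps_add PS_zero PS_add)

lemma PS_induct [consumes 1, case_names one psum add mult]:
  assumes "c \<in> PS" "Q 1" "\<And>k. k \<ge> 1 \<Longrightarrow> Q (psum k)"
    "\<And>a b. a \<in> PS \<Longrightarrow> b \<in> PS \<Longrightarrow> Q a \<Longrightarrow> Q b \<Longrightarrow> Q (a + b)"
    "\<And>a b. a \<in> PS \<Longrightarrow> b \<in> PS \<Longrightarrow> Q a \<Longrightarrow> Q b \<Longrightarrow> Q (a * b)"
  shows "Q c"
  using assms(1) unfolding PS_def
proof (induction rule: generate_ring.induct)
  case (eng_add a b)
  then show ?case using assms(4) by (simp add: PS_def)
next
  case (eng_mult a b)
  then show ?case using assms(5) by (simp add: PS_def)
qed (use assms(2,3) in auto)

lemma PS_subset_S: "c \<in> PS \<Longrightarrow> c \<in> S"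
  by (induction rule: PS_induct) (auto intro: psum_in_S)

lemma S_decomp: "x \<in> S \<Longrightarrow> x = eps x + d (htpy x)"
  using homotopy[of x] by (simp add: S_iff ac_simps)

text \<open>This handles a normal form whose image vanishes. Since \<open>eps\<close> kills dx and
  fixes \<open>eps c\<close>, the two summands vanish separately.\<close>

lemma d_eq_eps:
  assumes "d x = eps c"
  shows "eps c = 0" "x = eps x + d (htpy x)"
proof -
  have "x + eps x = d (htpy x)"
    using homotopy[of x] by (simp add: assms htpy_eps)
  then show "x = eps x + d (htpy x)"
    by (metis add.commute add_self_left)
  have "eps (eps c) = eps c"
  proof (induction c rule: std_induct3)
    case (std P A I)
    then show ?case
      by (simp add: eps_std_elt eps_pprod std_indices_iff del: One_nat_def)
  qed (simp_all add: eps_add)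
  then show "eps c = 0"
    using eps_d[of x] assms by simp
qed

section \<open>The lift of $d$ to the free algebra\<close>

abbreviation Yprod :: "nat multiset \<Rightarrow> F_ambient" where "Yprod I \<equiv> \<Prod>i\<in>#I. delta (w (2 * i))"

abbreviation dsq :: "nat set \<Rightarrow> F_ambient" where "dsq A \<equiv> delta (sqf_even A)"

lemma delta_eq_std_lin: "delta = std_lin delta_std"
  by (rule ext) (simp add: delta_def std_lin_def)

lemma delta_0 [simp]: "delta 0 = 0"
  and delta_add: "delta (x + y) = delta x + delta y"
  and delta_sum: "delta (\<Sum>i\<in>K. f i) = (\<Sum>i\<in>K. delta (f i))"
  by (simp_all add: delta_eq_std_lin std_lin_add std_lin_sum)

lemma delta_std_elt: "t \<in> std_indices \<Longrightarrow> delta (std_elt t) = delta_std t"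
  by (simp add: delta_eq_std_lin std_lin_std_elt)

lemma delta_sqf_even:
  assumes "finite A" "A \<subseteq> {1..}"
  shows "delta (sqf_even A) = delta_sqf (sqf_even A)"
  using delta_std_elt[of "({}, A, {#})"] assms
  by (simp add: std_indices_iff std_elt_eq delta_std_def)

lemma delta_1 [simp]: "delta 1 = 0"
  using delta_sqf_even[of "{}"] by (simp add: delta_sqf_def)

text \<open>The index 0, which occurs in relation (1), is included: there w is 1 and both sides are
  0.\<close>

lemma delta_w: "delta (w (2 * i)) = delta_sqf (w (2 * i))"
  using delta_sqf_even[of "{i}"] by (cases "i = 0") (simp_all add: sqf_even_singleton delta_sqf_def)

lemma delta_std:
  assumes "(P, A, I) \<in> std_indices"
  shows "delta (std_elt (P, A, I)) = Const (pprod P) * dsq A * Yprod I"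
  using assms by (simp add: delta_std_elt delta_sqf_even std_indices_iff delta_w) (simp add: delta_std_def)

text \<open>Uniqueness of expansions separates these monomials. With B = {} it shows that a nonempty
  product differs from 1, so that its \<open>delta\<close> is a free variable.\<close>

lemma sqf_even_inj:
  assumes "finite A" "A \<subseteq> {1..}" "finite B" "B \<subseteq> {1..}" "sqf_even A = sqf_even B"
  shows "A = B"
proof -
  have "std_expansion (sqf_even C) = {({}, C, {#})}" if "finite C" "C \<subseteq> {1..}" for C
    using that by (intro std_expansion_unique) (auto simp: std_indices_iff std_elt_eq)
  from this[OF assms(1,2)] this[OF assms(3,4)] have "{({} :: nat set, A, {#} :: nat multiset)} = {({}, B, {#})}"
    unfolding assms(5) by (rule trans[OF sym])
  then show ?thesis
    by simp
qed

lemma dsq_Var: "finite A \<Longrightarrow> A \<subseteq> {1..} \<Longrightarrow> A \<noteq> {} \<Longrightarrow> dsq A = Var (sqf_even A)"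
  using sqf_even_inj[of A "{}"] by (auto simp: delta_sqf_even delta_sqf_def)

text \<open>For i \<ge> 1, multiplication by dw_{2i} adds i to the multiset of a basis element, so
  this is an equality in F itself. Read backwards, it turns a product with the symbol of a single
  variable into one \<open>delta\<close>.\<close>

lemma delta_dw_mult: "delta (d (w (2 * i)) * x) = delta (w (2 * i)) * delta x"
proof (cases "i = 0")
  case False
  show ?thesis
  proof (induction x rule: std_induct3)
    case (std P A I)
    then have "(P, A, add_mset i I) \<in> std_indices"
      using False by (simp add: std_indices_iff)
    moreover have "d (w (2 * i)) * std_elt (P, A, I) = std_elt (P, A, add_mset i I)"
      by (simp add: std_elt_eq ac_simps)
    ultimately show ?case
      using std by (simp add: delta_std ac_simps)
  qed (simp_all add: delta_add ring_distribs)
qed simp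

lemma delta_yprod_mult: "delta (yprod I * x) = Yprod I * delta x"
  by (induction I) (simp_all add: delta_dw_mult mult.assoc)

interpretation F: cring "ring_on F"
  by (rule cring_F)

lemma F_closed: "0 \<in> F" "1 \<in> F" "f \<in> F \<Longrightarrow> g \<in> F \<Longrightarrow> f + g \<in> F" "f \<in> F \<Longrightarrow> g \<in> F \<Longrightarrow> f * g \<in> F"
  using F.zero_closed F.one_closed F.a_closed[of f g] F.m_closed[of f g] by simp_all

lemma F_sum: "(\<And>i. i \<in> A \<Longrightarrow> f i \<in> F) \<Longrightarrow> sum f A \<in> F"
  by (induction A rule: infinite_finite_induct) (auto simp: F_closed)

lemma F_prod_mset: "(\<And>i. i \<in># A \<Longrightarrow> f i \<in> F) \<Longrightarrow> (\<Prod>i\<in>#A. f i) \<in> F"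
  by (induction A) (auto simp: F_closed)

lemma F_prod: "(\<And>i. i \<in> A \<Longrightarrow> f i \<in> F) \<Longrightarrow> prod f A \<in> F"
  by (induction A rule: infinite_finite_induct) (auto simp: F_closed)

lemma F_Const: "c \<in> PS \<Longrightarrow> Const c \<in> F"
  by (auto simp: F_def Const_def)

lemma F_Var: "a \<in> pos_sqf_monomials \<Longrightarrow> Var a \<in> F"
  by (auto simp: F_def Var_def PS_one)

lemma dsq_in_F:
  assumes "finite A" "A \<subseteq> {1..}"
  shows "dsq A \<in> F"
proof (cases "A = {}")
  case False
  then show ?thesis
    using assms unfolding dsq_Var[OF assms False] by (intro F_Var) (auto simp: pos_sqf_monomials_def)
qed (simp add: F_closed)

lemma delta_w_in_F: "delta (w (2 * i)) \<in> F"
  using dsq_in_F[of "{i}"] by (cases "i = 0") (simp_all add: sqf_even_singleton F_closed)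

lemma Yprod_in_F: "Yprod I \<in> F"
  by (rule F_prod_mset) (rule delta_w_in_F)

lemma delta_in_F: "delta x \<in> F"
proof (induction x rule: std_induct3)
  case (std P A I)
  then show ?case
    unfolding delta_std[OF std] std_indices_iff
    by (intro F_closed(4) F_Const PS_pprod dsq_in_F Yprod_in_F) auto
qed (simp_all add: F_closed delta_add)

interpretation F_to_S: mp_eval_hom "\<lambda>c::R. c" d
  by standard simp_all

lemma F_to_S_add: "F_to_S (f + g) = F_to_S f + F_to_S g"
  and F_to_S_mult: "F_to_S (f * g) = F_to_S f * F_to_S g"
  and F_to_S_0: "F_to_S 0 = 0" and F_to_S_1: "F_to_S 1 = 1"
  and F_to_S_Const: "F_to_S (Const c) = c" and F_to_S_Var: "F_to_S (Var a) = d a"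
  and F_to_S_sum: "F_to_S (\<Sum>i\<in>K. h i) = (\<Sum>i\<in>K. F_to_S (h i))"
  unfolding F_to_S_def
  by (rule F_to_S.mp_eval_add F_to_S.mp_eval_mult F_to_S.mp_eval_0 F_to_S.mp_eval_1 F_to_S.mp_eval_Const
    F_to_S.mp_eval_Var F_to_S.mp_eval_sum)+

lemma F_to_S_in_S:
  assumes "f \<in> F" shows "F_to_S f \<in> S"
proof -
  have "d v ^ n \<in> S" for v n
    by (induction n) (auto simp: d_in_S)
  then show ?thesis
    using assms unfolding F_to_S_def mp_eval_def
    by (intro S_sum S_closed(4) S_prod) (auto simp: F_def intro: PS_subset_S)
qed

lemma F_to_S_delta_sqf: "F_to_S (delta_sqf a) = d a"
  by (simp add: delta_sqf_def F_to_S_Var F_to_S_0)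

lemma F_to_S_delta: "F_to_S (delta x) = d x"
proof (induction x rule: std_induct3)
  case (std P A I)
  note fin = std[unfolded std_indices_iff]
  have Y: "F_to_S (Yprod I) = yprod I"
    by (induction I) (simp_all add: F_to_S_1 F_to_S_mult delta_w F_to_S_delta_sqf)
  have "d (std_elt (P, A, I)) = pprod P * (yprod I * d (sqf_even A))"
  proof -
    have "pprod P \<in> S" "yprod I \<in> S"
      by (auto intro: S_prod S_prod_mset psum_in_S d_in_S)
    moreover have "std_elt (P, A, I) = pprod P * (yprod I * sqf_even A)"
      by (simp add: std_elt_eq ac_simps)
    ultimately show ?thesis
      by (simp only: d_mult_S)
  qed
  then show ?case
    unfolding delta_std[OF std] F_to_S_mult F_to_S_Const Y
    using fin by (simp add: delta_sqf_even F_to_S_delta_sqf ac_simps)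
qed (simp_all add: delta_add F_to_S_add F_to_S_0 d_add)

section \<open>Computations modulo the relations\<close>

definition rel_ideal :: "F_ambient set"
  where "rel_ideal = Idl\<^bsub>ring_on F\<^esub> (relations1 \<union> relations2)"

lemma w_in_sqf_even: "\<exists>A. finite A \<and> A \<subseteq> {1..} \<and> w (2 * i) = sqf_even A"
proof (cases "i = 0")
  case True
  then show ?thesis by (intro exI[of _ "{}"]) simp
next
  case False
  then show ?thesis by (intro exI[of _ "{i}"]) (simp add: sqf_even_singleton)
qed

lemma relations_in_F: "relations1 \<union> relations2 \<subseteq> F"
proof -
  have "odd k \<Longrightarrow> k \<ge> 1" for k :: nat
    by (simp add: odd_pos Suc_leI)
  then show ?thesis
    unfolding relations1_def relations2_def power2_eq_square
    by (auto intro!: F_closed F_Const PS_mult PS_psum F_sum delta_in_F)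
qed

lemma rel_ideal_ideal: "ideal rel_ideal (ring_on F)"
  unfolding rel_ideal_def by (rule F.genideal_ideal) (simp only: ring_on_simps relations_in_F)

lemma rel_ideal_0: "0 \<in> rel_ideal" and rel_ideal_add: "f \<in> rel_ideal \<Longrightarrow> g \<in> rel_ideal \<Longrightarrow> f + g \<in> rel_ideal"
  and rel_ideal_mult: "g \<in> F \<Longrightarrow> f \<in> rel_ideal \<Longrightarrow> g * f \<in> rel_ideal"
  using additive_subgroup.zero_closed[OF ideal.axioms(1)[OF rel_ideal_ideal]]
    additive_subgroup.a_closed[OF ideal.axioms(1)[OF rel_ideal_ideal], of f g] ideal.I_l_closed[OF rel_ideal_ideal, of f g]
  by simp_all

lemma relations_in_rel_ideal: "relations1 \<union> relations2 \<subseteq> rel_ideal"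
  unfolding rel_ideal_def by (rule F.genideal_self) (simp only: ring_on_simps relations_in_F)

text \<open>The kernel is an ideal, so generators suffice. Relation (1) becomes
  \<open>psum_square_odd\<close>. In (2) the mixed terms of \<open>d_mult\<close> occur in pairs,
  and dx dy dz remains three times.\<close>

lemma rel_ideal_in_kernel: "f \<in> rel_ideal \<Longrightarrow> F_to_S f = 0"
proof -
  have S: "cring (ring_on S)"
    by (rule cring_ring_on) simp_all
  have "F_to_S \<in> ring_hom (ring_on F) (ring_on S)"
    by (rule ring_hom_memI) (simp_all add: F_to_S_in_S F_to_S_mult F_to_S_add F_to_S_1)
  then have "ring_hom_ring (ring_on F) (ring_on S) F_to_S"
    using S cring_F by (intro ring_hom_ringI2) (auto intro: cring.axioms)
  then have ker: "ideal (a_kernel (ring_on F) (ring_on S) F_to_S) (ring_on F)"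
    by (rule ring_hom_ring.kernel_is_ideal)
  have r1: "F_to_S f = 0" if "f \<in> relations1" for f
  proof -
    obtain k where k: "odd k" "f = Const ((psum k)\<^sup>2) - (\<Sum>i=0..(k - 1) div 2.
         delta (w (2 * i) * w (2 * (k - i))) + delta (w (2 * i)) * delta (w (2 * (k - i))))"
      using \<open>f \<in> relations1\<close> unfolding relations1_def by blast
    have "F_to_S f = (psum k)\<^sup>2 + (\<Sum>i=0..(k - 1) div 2. w (2*i) * d (w (2*(k-i))) + d (w (2*i)) * w (2*(k-i)))"
      unfolding k by (simp add: F_to_S_add F_to_S_Const F_to_S_sum F_to_S_mult F_to_S_delta d_mult ac_simps)
    then show ?thesis
      by (simp add: psum_square_odd[OF k(1)])
  qed
  have r2: "F_to_S f = 0" if "f \<in> relations2" for f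
  proof -
    obtain x y z where "f = delta (y * z) * delta x + delta (x * z) * delta y + delta (x * y) * delta z
       - delta x * delta y * delta z"
      using \<open>f \<in> relations2\<close> unfolding relations2_def by blast
    then show ?thesis
      by (simp add: F_to_S_add F_to_S_mult F_to_S_delta d_mult ring_distribs ac_simps)
  qed
  have "rel_ideal \<subseteq> a_kernel (ring_on F) (ring_on S) F_to_S"
    unfolding rel_ideal_def using relations_in_F r1 r2
    by (intro F.genideal_minimal[OF ker]) (auto simp: a_kernel_def')
  then show "f \<in> rel_ideal \<Longrightarrow> F_to_S f = 0"
    by (auto simp: a_kernel_def')
qed

lemma relation1:
  assumes "odd k"
  shows "Const ((psum k)\<^sup>2) + (\<Sum>j=0..(k - 1) div 2.
    delta (w (2 * j) * w (2 * (k - j))) + delta (w (2 * j)) * delta (w (2 * (k - j)))) \<in> rel_ideal"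
  using relations_in_rel_ideal assms unfolding relations1_def by auto

lemma relation2:
  assumes "finite A" "A \<subseteq> {1..}" "finite B" "B \<subseteq> {1..}" "finite C" "C \<subseteq> {1..}"
  shows "delta (sqf_even B * sqf_even C) * dsq A + delta (sqf_even A * sqf_even C) * dsq B
    + delta (sqf_even A * sqf_even B) * dsq C + dsq A * dsq B * dsq C \<in> rel_ideal"
  using relations_in_rel_ideal assms unfolding relations2_def sqf_monomials_def diff_eq_add by blast

definition eq_mod :: "F_ambient \<Rightarrow> F_ambient \<Rightarrow> bool" (infix "\<approx>" 50)
  where "f \<approx> g \<longleftrightarrow> f + g \<in> rel_ideal"

lemma eq_mod_refl [simp]: "f \<approx> f"
  by (simp add: eq_mod_def rel_ideal_0)

lemma eq_mod_sym: "f \<approx> g \<Longrightarrow> g \<approx> f"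
  by (simp add: eq_mod_def add.commute)

lemma eq_mod_trans [trans]: "f \<approx> g \<Longrightarrow> g \<approx> h \<Longrightarrow> f \<approx> h"
  unfolding eq_mod_def using rel_ideal_add[of "f + g" "g + h"] by (simp add: ac_simps)

lemma eq_mod_eq_trans [trans]: "f \<approx> g \<Longrightarrow> g = h \<Longrightarrow> f \<approx> h" "f = g \<Longrightarrow> g \<approx> h \<Longrightarrow> f \<approx> h"
  by simp_all

lemma eq_mod_add: "f \<approx> g \<Longrightarrow> f' \<approx> g' \<Longrightarrow> f + f' \<approx> g + g'"
  unfolding eq_mod_def using rel_ideal_add[of "f + g" "f' + g'"] by (simp add: ac_simps)

lemma eq_mod_sum: "(\<And>i. i \<in> A \<Longrightarrow> f i \<approx> g i) \<Longrightarrow> sum f A \<approx> sum g A"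
  by (induction A rule: infinite_finite_induct) (auto intro: eq_mod_add)

lemma eq_mod_mult: "h \<in> F \<Longrightarrow> f \<approx> g \<Longrightarrow> h * f \<approx> h * g"
  unfolding eq_mod_def using rel_ideal_mult[of h "f + g"] by (simp add: distrib_left)

text \<open>Relation (2) allows merging \<open>m\<close> into the block \<open>V\<close>, one element of \<open>B\<close> at a time.\<close>

lemma dsq_merge:
  assumes "finite B" "B \<subseteq> {1..}" "finite V" "V \<subseteq> {1..}" "B \<inter> V = {}"
  shows "(\<Sum>C\<in>Pow B. (dsq (C \<union> V) + dsq C * dsq V) * (\<Prod>i\<in>B-C. delta (w (2 * i)))) \<approx> dsq (B \<union> V)"
  using assms
proof (induction B arbitrary: V rule: finite_induct)
  case (insert m B)
  let ?Y = "\<lambda>X. \<Prod>i\<in>X. delta (w (2 * i))"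
  let ?Vm = "insert m V"
  define g where "g = (\<lambda>C. (dsq (C \<union> V) + dsq C * dsq V) * ?Y (insert m B - C))"
  \<comment> \<open>Subsets of \<open>insert m B\<close> are paired as C and
    \<open>insert m C\<close>. A pair and its replacement differ by a multiple of relation (2) for
    the monomials of C, {m} and V.\<close>
  have g: "g C + g (insert m C) \<approx> (dsq (C \<union> ?Vm) + dsq C * dsq ?Vm) * ?Y (B - C)" if "C \<in> Pow B" for C
  proof -
    have C: "finite C" "C \<subseteq> {1..}" "m \<notin> C" "C \<inter> V = {}" and m: "m \<notin> V" "m \<ge> 1"
      using that insert.prems insert.hyps finite_subset[of C B] by auto
    have "insert m B - C = insert m (B - C)" "insert m B - insert m C = B - C"
      using C insert.hyps by auto
    then have "g C = (dsq (C \<union> V) + dsq C * dsq V) * delta (w (2 * m)) * ?Y (B - C)"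
      and "g (insert m C) = (dsq (C \<union> ?Vm) + dsq (insert m C) * dsq V) * ?Y (B - C)"
      using insert.hyps by (simp_all add: g_def ac_simps)
    moreover have "dsq (insert m C) = delta (sqf_even C * sqf_even {m})"
      "dsq ?Vm = delta (sqf_even {m} * sqf_even V)" "dsq (C \<union> V) = delta (sqf_even C * sqf_even V)"
      using C m insert.prems sqf_even_union[of C "{m}"] sqf_even_union[of "{m}" V] sqf_even_union[of C V]
      by simp_all
    moreover have "dsq {m} = delta (w (2 * m))"
      by (simp add: sqf_even_singleton)
    ultimately have "(g C + g (insert m C)) + (dsq (C \<union> ?Vm) + dsq C * dsq ?Vm) * ?Y (B - C) =
      ?Y (B - C) * (delta (sqf_even {m} * sqf_even V) * dsq C + delta (sqf_even C * sqf_even V) * dsq {m}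
      + delta (sqf_even C * sqf_even {m}) * dsq V + dsq C * dsq {m} * dsq V)"
      by (simp add: ring_distribs ac_simps)
    also have "\<dots> \<in> rel_ideal"
      using C m insert.prems by (intro rel_ideal_mult relation2 F_prod delta_w_in_F) auto
    finally show ?thesis
      by (simp add: eq_mod_def)
  qed
  have "(\<Sum>C\<in>Pow (insert m B). g C) = (\<Sum>C\<in>Pow B. g C) + (\<Sum>C\<in>insert m ` Pow B. g C)"
    unfolding Pow_insert using insert.hyps by (intro sum.union_disjoint) auto
  also have "(\<Sum>C\<in>insert m ` Pow B. g C) = (\<Sum>C\<in>Pow B. g (insert m C))"
    using insert.hyps by (subst sum.reindex) (auto simp: inj_on_def)
  also have "(\<Sum>C\<in>Pow B. g C) + \<dots> \<approx> (\<Sum>C\<in>Pow B. (dsq (C \<union> ?Vm) + dsq C * dsq ?Vm) * ?Y (B - C))"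
    unfolding sum.distrib[symmetric] by (rule eq_mod_sum) (rule g)
  also have "\<dots> \<approx> dsq (B \<union> ?Vm)"
    using insert.prems insert.hyps by (intro insert.IH) auto
  finally show ?case
    by (simp add: g_def)
qed simp

lemma delta_d_in_rel_ideal: "delta (d x) \<in> rel_ideal"
proof (induction x rule: std_induct3)
  case (std P A I)
  note fin = std[unfolded std_indices_iff]
  have "delta (omega (std_elt (P, A, I))) = (\<Sum>B\<in>Pow A. delta (std_elt (P, B, I + mset_set (A - B))))"
    using fin by (simp add: omega_std_elt delta_sum)
  also have "\<dots> = (\<Sum>B\<in>Pow A. Const (pprod P) * dsq B * Yprod (I + mset_set (A - B)))"
    by (intro sum.cong refl delta_std std_indices_Pow std)
  \<comment> \<open>Since \<open>dsq {}\<close> is 0, the sum has the shape of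
    \<open>dsq_merge\<close> with an empty block V.\<close>
  also have "\<dots> = (Const (pprod P) * Yprod I) *
      (\<Sum>B\<in>Pow A. (dsq (B \<union> {}) + dsq B * dsq {}) * (\<Prod>i\<in>A-B. delta (w (2 * i))))"
    by (simp add: sum_distrib_left prod_unfold_prod_mset ac_simps)
  also have "\<dots> \<approx> (Const (pprod P) * Yprod I) * dsq (A \<union> {})"
    using fin by (intro eq_mod_mult F_closed F_Const PS_pprod Yprod_in_F dsq_merge) auto
  also have "\<dots> = delta (std_elt (P, A, I))"
    by (simp add: delta_std[OF std] ac_simps)
  finally show ?case
    by (simp add: eq_mod_def d_def delta_add add.commute)
qed (simp_all add: rel_ideal_0 d_add delta_add rel_ideal_add)

section \<open>Linearity of delta over the odd power sums modulo the relations\<close>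

lemma wdeg_expo:
  "wdeg (expo (P, A, I)) \<ge> (\<Sum>i\<in>P. 2 * i - 1) + (\<Sum>i\<in>A. 2 * i)" if "P \<subseteq> {1..}" "A \<subseteq> {1..}"
proof -
  have "(\<Sum>i\<in>P. 2 * i - 1) = wdeg (\<Sum>i\<in>P. Poly_Mapping.single (2 * i - 2) 1)"
    unfolding wdeg_sum using that by (intro sum.cong) (force simp: wdeg_single)+
  moreover have "(\<Sum>i\<in>A. 2 * i) = wdeg (\<Sum>i\<in>A. Poly_Mapping.single (2 * i - 1) 1)"
    unfolding wdeg_sum using that by (intro sum.cong) (force simp: wdeg_single)+
  ultimately show ?thesis
    by (simp add: expo_def wdeg_add)
qed

lemma filt_prod: "(\<And>i. i \<in> A \<Longrightarrow> f i \<in> filt (n i) 0) \<Longrightarrow> prod f A \<in> filt (sum n A) 0"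
proof (induction A rule: infinite_finite_induct)
  case (insert a A)
  then show ?case
    using filt_mult[of "f a" "n a" 0 "prod f A" "sum n A" 0] by simp
qed (simp_all add: filt_1)

lemma filt_pprod: "P \<subseteq> {1..} \<Longrightarrow> pprod P \<in> filt (\<Sum>i\<in>P. 2 * i - 1) 0"
proof (rule filt_prod)
  fix i assume "P \<subseteq> {1..}" "i \<in> P"
  then have "2 * i - 1 \<ge> 1" by force
  from filt_psum[OF this] show "psum (2 * i - 1) \<in> filt (2 * i - 1) 0"
    by (rule filt_mono) auto
qed

lemma filt_sqf_even: "sqf_even A \<in> filt (\<Sum>i\<in>A. 2 * i) 0"
  unfolding sqf_even_def by (rule filt_prod) (rule filt_w0)

text \<open>Multiply (1) by the symbol of a and apply (2) to a, u = w_{2j}, v = w_{2(k-j)}. Every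
  term then has the symbol of u or of v as a factor, and the result is what \<open>delta\<close>
  gives on the expansion of p_k^2 a by \<open>psum_square_odd\<close>.\<close>

lemma relation1_mult_dsq:
  assumes "odd k" "finite A" "A \<subseteq> {1..}"
  shows "Const ((psum k)\<^sup>2) * dsq A \<approx> (\<Sum>j=0..(k - 1) div 2.
    delta (sqf_even A * w (2 * j)) * delta (w (2 * (k - j)))
    + delta (sqf_even A * w (2 * (k - j))) * delta (w (2 * j)))"
proof -
  let ?s = "\<lambda>j. delta (w (2 * j) * w (2 * (k - j))) + delta (w (2 * j)) * delta (w (2 * (k - j)))"
  have "dsq A * Const ((psum k)\<^sup>2) \<approx> dsq A * (\<Sum>j=0..(k - 1) div 2. ?s j)"
    using relation1[OF assms(1)] by (intro eq_mod_mult delta_in_F) (simp add: eq_mod_def)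
  also have "\<dots> = (\<Sum>j=0..(k - 1) div 2. dsq A * ?s j)"
    by (rule sum_distrib_left)
  also have "\<dots> \<approx> (\<Sum>j=0..(k - 1) div 2. delta (sqf_even A * w (2 * j)) * delta (w (2 * (k - j)))
    + delta (sqf_even A * w (2 * (k - j))) * delta (w (2 * j)))"
  proof (rule eq_mod_sum)
    fix j
    obtain B C where "finite B" "B \<subseteq> {1..}" "w (2 * j) = sqf_even B"
      "finite C" "C \<subseteq> {1..}" "w (2 * (k - j)) = sqf_even C"
      using w_in_sqf_even by metis
    with relation2[OF assms(2,3), of B C]
    show "dsq A * ?s j \<approx> delta (sqf_even A * w (2 * j)) * delta (w (2 * (k - j)))
      + delta (sqf_even A * w (2 * (k - j))) * delta (w (2 * j))"
      unfolding eq_mod_def by (simp add: ring_distribs ac_simps)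
  qed
  finally show ?thesis
    by (simp add: mult.commute)
qed

text \<open>The degree decreases because a factor \<^term>\<open>d (w (2 * j))\<close> with \<open>j \<ge> 1\<close>, over which
  \<^const>\<open>delta\<close> is linear by construction, splits off from the rewritten square of the power sum.\<close>

lemma delta_psum_filt:
  "i \<ge> 1 \<Longrightarrow> x \<in> filt m 0 \<Longrightarrow> 2 * i - 1 + m \<le> N \<Longrightarrow>
    delta (psum (2 * i - 1) * x) \<approx> Const (psum (2 * i - 1)) * delta x"
proof (induction N arbitrary: i x m rule: less_induct)
  case (less N)
  \<comment> \<open>Power sums are pulled out one at a time, each time in total degree below N,
    where the outer induction hypothesis applies.\<close>
  have pprod: "delta (pprod P * y) \<approx> Const (pprod P) * delta y"
    if "finite P" "P \<subseteq> {1..}" "y \<in> filt n 0" "(\<Sum>i\<in>P. 2 * i - 1) + n < N" for P y n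
    using that
  proof (induction P rule: finite_induct)
    case (insert i P)
    have deg: "2 * i - 1 + ((\<Sum>i\<in>P. 2 * i - 1) + n) < N"
      using insert by (simp add: add.assoc)
    have "pprod P * y \<in> filt ((\<Sum>i\<in>P. 2 * i - 1) + n) 0"
      using filt_mult[OF filt_pprod[of P] insert.prems(2)] insert.prems(1) by simp
    then have "delta (psum (2 * i - 1) * (pprod P * y)) \<approx> Const (psum (2 * i - 1)) * delta (pprod P * y)"
      using insert.prems deg by (intro less.IH[OF deg]) auto
    also have "\<dots> \<approx> Const (psum (2 * i - 1)) * (Const (pprod P) * delta y)"
      using insert.prems deg by (intro eq_mod_mult F_Const PS_psum insert.IH) auto
    finally show ?case
      using insert.hyps by (simp add: Const_mult mult.assoc)
  qed simp
  define k where "k = 2 * i - 1"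
  have k: "odd k" "k \<ge> 1"
    using less.prems(1) by (auto simp: k_def)
  have std: "delta (psum k * std_elt (P, A, I)) \<approx> Const (psum k) * delta (std_elt (P, A, I))"
    if t: "(P, A, I) \<in> std_indices" and deg: "wdeg (expo (P, A, I)) \<le> m" for P A I
  proof (cases "i \<in> P")
    case False
    note fin = t[unfolded std_indices_iff]
    have "(insert i P, A, I) \<in> std_indices"
      using t less.prems(1) by (simp add: std_indices_iff)
    moreover have "pprod (insert i P) = psum k * pprod P"
      using False fin by (simp add: k_def)
    ultimately show ?thesis
      using delta_std[of "insert i P" A I] delta_std[OF t]
      by (simp only: std_elt_eq) (simp add: Const_mult ac_simps)
  next
    case True
    note fin = t[unfolded std_indices_iff]
    define P' where "P' = P - {i}"
    have P': "finite P'" "P' \<subseteq> {1..}" and pprod_P: "pprod P = psum k * pprod P'"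
      using fin True by (auto simp: P'_def k_def prod.remove)
    let ?a = "sqf_even A" and ?J = "{0..(k - 1) div 2}"
    let ?A = "\<Sum>i\<in>A. 2 * i"
    have "(\<Sum>i\<in>P. 2 * i - 1) = k + (\<Sum>i\<in>P'. 2 * i - 1)"
      using fin True by (simp add: P'_def k_def sum.remove)
    then have N: "2 * k + (\<Sum>i\<in>P'. 2 * i - 1) + ?A \<le> N"
      using wdeg_expo[of P A I] deg less.prems(3) fin unfolding k_def[symmetric] by linarith
    \<comment> \<open>For l = 0 the factor \<open>delta (w 0)\<close> is 0. Otherwise j < k, and
      splitting off dw_{2l} has lowered the degree below N.\<close>
    have step: "delta (w (2 * l)) * delta (pprod P' * (?a * w (2 * j)))
        \<approx> delta (w (2 * l)) * (Const (pprod P') * delta (?a * w (2 * j)))"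
      if "j + l = k" for j l
    proof (cases "l = 0")
      case False
      then have "(\<Sum>i\<in>P'. 2 * i - 1) + (?A + 2 * j) < N"
        using N that by linarith
      then show ?thesis
        using filt_mult[OF filt_sqf_even[of A] filt_w0[of "2 * j"]]
        by (intro eq_mod_mult delta_in_F pprod P') simp_all
    qed simp
    have "psum k * std_elt (P, A, I) = (psum k)\<^sup>2 * (pprod P' * ?a * yprod I)"
      unfolding std_elt_eq pprod_P power2_eq_square by (simp only: ac_simps)
    also have "\<dots> = yprod I * (\<Sum>j\<in>?J. d (w (2 * (k - j))) * (pprod P' * (?a * w (2 * j)))
        + d (w (2 * j)) * (pprod P' * (?a * w (2 * (k - j)))))"
      unfolding psum_square_odd[OF k(1)] sum_distrib_left sum_distrib_right
      by (rule sum.cong) (simp_all add: ring_distribs ac_simps)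
    finally have "delta (psum k * std_elt (P, A, I)) =
        Yprod I * (\<Sum>j\<in>?J. delta (w (2 * (k - j))) * delta (pprod P' * (?a * w (2 * j)))
        + delta (w (2 * j)) * delta (pprod P' * (?a * w (2 * (k - j)))))"
      by (simp only: delta_yprod_mult delta_sum delta_add delta_dw_mult)
    also have "\<dots> \<approx> Yprod I * (\<Sum>j\<in>?J. delta (w (2 * (k - j))) * (Const (pprod P') * delta (?a * w (2 * j)))
        + delta (w (2 * j)) * (Const (pprod P') * delta (?a * w (2 * (k - j)))))"
      by (intro eq_mod_mult Yprod_in_F eq_mod_sum eq_mod_add step) auto
    also have "\<dots> = (Yprod I * Const (pprod P')) * (\<Sum>j\<in>?J. delta (?a * w (2 * j)) * delta (w (2 * (k - j)))
        + delta (?a * w (2 * (k - j))) * delta (w (2 * j)))"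
      unfolding sum_distrib_left by (rule sum.cong) (simp_all add: ring_distribs ac_simps)
    also have "\<dots> \<approx> (Yprod I * Const (pprod P')) * (Const ((psum k)\<^sup>2) * dsq A)"
      using fin P'
      by (intro eq_mod_mult[OF _ eq_mod_sym] relation1_mult_dsq k F_closed Yprod_in_F F_Const PS_pprod) auto
    also have "\<dots> = Const (psum k) * delta (std_elt (P, A, I))"
      unfolding delta_std[OF t] pprod_P Const_mult power2_eq_square by (simp only: ac_simps)
    finally show ?thesis .
  qed
  have "(\<Sum>t\<in>std_expansion x. delta (psum k * std_elt t))
      \<approx> (\<Sum>t\<in>std_expansion x. Const (psum k) * delta (std_elt t))"
  proof (rule eq_mod_sum)
    fix t assume "t \<in> std_expansion x"
    then show "delta (psum k * std_elt t) \<approx> Const (psum k) * delta (std_elt t)"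
      using std_expansion_filt[OF less.prems(2)] by (cases t) (auto intro!: std)
  qed
  moreover have "(\<Sum>t\<in>std_expansion x. delta (psum k * std_elt t)) = delta (psum k * x)"
    using std_expansion(3)[of x] by (simp flip: delta_sum sum_distrib_left)
  moreover have "(\<Sum>t\<in>std_expansion x. Const (psum k) * delta (std_elt t)) = Const (psum k) * delta x"
    using std_expansion(3)[of x] by (simp flip: delta_sum sum_distrib_left)
  ultimately show ?case
    by (simp add: k_def)
qed

lemma delta_psum: "i \<ge> 1 \<Longrightarrow> delta (psum (2 * i - 1) * x) \<approx> Const (psum (2 * i - 1)) * delta x"
  using delta_psum_filt[OF _ _ order_refl] in_filt[of x] by blast

lemma delta_pprod: "finite P \<Longrightarrow> P \<subseteq> {1..} \<Longrightarrow> delta (pprod P * x) \<approx> Const (pprod P) * delta x"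
proof (induction P rule: finite_induct)
  case (insert i P)
  have "delta (psum (2 * i - 1) * (pprod P * x)) \<approx> Const (psum (2 * i - 1)) * delta (pprod P * x)"
    using insert.prems by (intro delta_psum) auto
  also have "\<dots> \<approx> Const (psum (2 * i - 1)) * (Const (pprod P) * delta x)"
    using insert.prems by (intro eq_mod_mult F_Const PS_psum insert.IH) auto
  finally show ?case
    using insert.hyps by (simp add: Const_mult mult.assoc)
qed simp

section \<open>Normal forms in F modulo the relations\<close>

definition delta_form :: "F_ambient set"
  where "delta_form = {f. \<exists>c x. f \<approx> Const (eps c) + delta x}"

lemma delta_form_cong: "f \<approx> g \<Longrightarrow> g \<in> delta_form \<Longrightarrow> f \<in> delta_form"
  unfolding delta_form_def using eq_mod_trans by blast

lemma delta_form_delta: "delta x \<in> delta_form"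
  unfolding delta_form_def by (intro CollectI exI[of _ 0] exI[of _ x]) simp

lemma delta_form_Const: "Const (eps c) \<in> delta_form"
  unfolding delta_form_def by (intro CollectI exI[of _ c] exI[of _ 0]) simp

lemma delta_form_0: "0 \<in> delta_form"
  using delta_form_delta[of 0] by simp

lemma delta_form_add: "f \<in> delta_form \<Longrightarrow> g \<in> delta_form \<Longrightarrow> f + g \<in> delta_form"
proof -
  assume "f \<in> delta_form" "g \<in> delta_form"
  then obtain c x c' x' where "f \<approx> Const (eps c) + delta x" "g \<approx> Const (eps c') + delta x'"
    by (auto simp: delta_form_def)
  from eq_mod_add[OF this] have "f + g \<approx> Const (eps (c + c')) + delta (x + x')"
    by (simp add: eps_add delta_add Const_add ac_simps)
  then show ?thesis
    by (auto simp: delta_form_def)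
qed

lemma delta_form_sum: "(\<And>i. i \<in> A \<Longrightarrow> f i \<in> delta_form) \<Longrightarrow> sum f A \<in> delta_form"
  by (induction A rule: infinite_finite_induct) (auto simp: delta_form_0 delta_form_add)

text \<open>The constant \<open>eps c\<close> is a sum of square-free products of odd power sums, so
  closure under multiplication by g is tested on such products and on single values of
  \<open>delta\<close>.\<close>

lemma delta_form_mult:
  assumes "f \<in> delta_form" "g \<in> F"
    and "\<And>P. finite P \<Longrightarrow> P \<subseteq> {1..} \<Longrightarrow> g * Const (pprod P) \<in> delta_form"
    and "\<And>x. g * delta x \<in> delta_form"
  shows "g * f \<in> delta_form"
proof -
  obtain c x where "f \<approx> Const (eps c) + delta x"
    using assms(1) by (auto simp: delta_form_def)
  then have "g * f \<approx> g * (Const (eps c) + delta x)"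
    by (rule eq_mod_mult[OF assms(2)])
  moreover have "g * Const (eps c) \<in> delta_form"
  proof (induction c rule: std_induct3)
    case (std P A I)
    then show ?case
      by (simp add: eps_std_elt assms(3) delta_form_0 std_indices_iff del: One_nat_def)
  qed (simp_all add: delta_form_0 delta_form_add eps_add Const_add distrib_left)
  then have "g * (Const (eps c) + delta x) \<in> delta_form"
    using assms(4) by (simp add: distrib_left delta_form_add)
  ultimately show ?thesis
    by (rule delta_form_cong)
qed

lemma delta_form_psum_odd:
  assumes "f \<in> delta_form" "i \<ge> 1"
  shows "Const (psum (2 * i - 1)) * f \<in> delta_form"
proof (rule delta_form_mult[OF assms(1)])
  show "Const (psum (2 * i - 1)) \<in> F"
    using assms(2) by (intro F_Const PS_psum) auto
  show "Const (psum (2 * i - 1)) * delta x \<in> delta_form" for x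
    using delta_psum[OF assms(2)] by (rule delta_form_cong[OF eq_mod_sym]) (rule delta_form_delta)
  fix P :: "nat set" assume P: "finite P" "P \<subseteq> {1..}"
  show "Const (psum (2 * i - 1)) * Const (pprod P) \<in> delta_form"
  proof (cases "i \<in> P")
    case False
    then have "(Const (psum (2 * i - 1)) * Const (pprod P) :: F_ambient) = Const (pprod (insert i P))"
      using P by (simp add: Const_mult)
    also have "\<dots> = Const (eps (pprod (insert i P)))"
      using P assms(2) by (subst eps_pprod) auto
    finally have eq: "(Const (psum (2 * i - 1)) * Const (pprod P) :: F_ambient) = Const (eps (pprod (insert i P)))" .
    show ?thesis
      unfolding eq by (rule delta_form_Const)
  next
    case True
    define k P' where "k = 2 * i - 1" and "P' = P - {i}"
    have P': "finite P'" "P' \<subseteq> {1..}" and pprod_P: "pprod P = psum k * pprod P'"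
      using P True by (auto simp: P'_def k_def prod.remove)
    have k: "odd k"
      using assms(2) by (auto simp: k_def)
    let ?s = "\<lambda>j. delta (w (2 * j) * w (2 * (k - j))) + delta (w (2 * j)) * delta (w (2 * (k - j)))"
    have "Const (pprod P') * Const ((psum k)\<^sup>2) \<approx> Const (pprod P') * (\<Sum>j=0..(k - 1) div 2. ?s j)"
      using relation1[OF k] P' by (intro eq_mod_mult F_Const PS_pprod) (simp_all add: eq_mod_def)
    \<comment> \<open>A product of symbols of single variables is the \<open>delta\<close> of du v,
      so (1) exhibits p_k^2 as one value of \<open>delta\<close>.\<close>
    also have "(\<Sum>j=0..(k - 1) div 2. ?s j) =
        delta (\<Sum>j=0..(k - 1) div 2. w (2 * j) * w (2 * (k - j)) + d (w (2 * j)) * w (2 * (k - j)))"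
      by (simp add: delta_sum delta_add delta_dw_mult)
    also have "Const (pprod P') * \<dots> \<approx>
        delta (pprod P' * (\<Sum>j=0..(k - 1) div 2. w (2 * j) * w (2 * (k - j)) + d (w (2 * j)) * w (2 * (k - j))))"
      using P' by (intro eq_mod_sym[OF delta_pprod])
    finally have "Const (pprod P') * Const ((psum k)\<^sup>2) \<in> delta_form"
      by (rule delta_form_cong) (rule delta_form_delta)
    moreover have "(Const (psum (2 * i - 1)) * Const (pprod P) :: F_ambient) = Const (pprod P') * Const ((psum k)\<^sup>2)"
      unfolding pprod_P Const_mult power2_eq_square k_def[symmetric] by (simp only: ac_simps)
    ultimately show ?thesis
      by (simp only:)
  qed
qed

text \<open>Even indices reduce to odd ones through p_{2l} = p_l^2.\<close>

lemma delta_form_psum: "k \<ge> 1 \<Longrightarrow> f \<in> delta_form \<Longrightarrow> Const (psum k) * f \<in> delta_form"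
proof (induction k arbitrary: f rule: less_induct)
  case (less k)
  show ?case
  proof (cases "even k")
    case True
    then obtain l where l: "k = 2 * l" by blast
    then have "Const (psum l) * (Const (psum l) * f) \<in> delta_form"
      using less by simp
    then show ?thesis
      unfolding l psum_square[symmetric] by (simp add: Const_mult power2_eq_square ac_simps)
  next
    case False
    then obtain l where "k = 2 * l + 1" by (rule oddE)
    then show ?thesis
      using delta_form_psum_odd[OF less.prems(2), of "Suc l"] by simp
  qed
qed

lemma delta_form_PS: "c \<in> PS \<Longrightarrow> f \<in> delta_form \<Longrightarrow> Const c * f \<in> delta_form"
proof (induction arbitrary: f rule: PS_induct)
  case (mult a b)
  then show ?case by (simp add: Const_mult mult.assoc)
qed (simp_all add: delta_form_psum Const_add distrib_right delta_form_add)

lemma delta_form_Y: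
  assumes "f \<in> delta_form" shows "delta (w (2 * i)) * f \<in> delta_form"
proof (rule delta_form_mult[OF assms delta_in_F])
  show "delta (w (2 * i)) * Const (pprod P) \<in> delta_form" if "finite P" "P \<subseteq> {1..}" for P
    using delta_pprod[OF that, of "w (2 * i)"]
    by (intro delta_form_cong[OF eq_mod_sym delta_form_delta]) (simp add: mult.commute)
  show "delta (w (2 * i)) * delta x \<in> delta_form" for x
    by (simp add: delta_form_delta flip: delta_dw_mult)
qed

lemma delta_form_Yprod: "f \<in> delta_form \<Longrightarrow> Yprod I * f \<in> delta_form"
  by (induction I) (simp_all add: delta_form_Y mult.assoc)

text \<open>Relation (2) moves one element of \<open>B\<close> at a time over to the other factor.\<close>

lemma delta_form_dsq: "finite B \<Longrightarrow> B \<subseteq> {1..} \<Longrightarrow> f \<in> delta_form \<Longrightarrow> dsq B * f \<in> delta_form"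
proof (induction B arbitrary: f rule: finite_induct)
  case (insert j B)
  show ?case
  proof (rule delta_form_mult[OF insert.prems(2) delta_in_F])
    show "dsq (insert j B) * Const (pprod P) \<in> delta_form" if "finite P" "P \<subseteq> {1..}" for P
      using delta_pprod[OF that, of "sqf_even (insert j B)"]
      by (intro delta_form_cong[OF eq_mod_sym delta_form_delta]) (simp add: mult.commute)
    fix x
    show "dsq (insert j B) * delta x \<in> delta_form"
    proof (induction x rule: std_induct3)
      case (std P A I)
      note fin = std[unfolded std_indices_iff]
      let ?b = "sqf_even B" and ?u = "w (2 * j)" and ?a = "sqf_even A"
      have "sqf_even (insert j B) = ?b * ?u"
        using sqf_even_union[of "{j}" B] insert.hyps by (simp add: sqf_even_singleton mult.commute)
      \<comment> \<open>This is relation (2) for a, b and u = w_{2j}. The products au and ab need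
        not be square-free, so the induction hypothesis is taken for arbitrary normal forms.\<close>
      then have "dsq (insert j B) * dsq A \<approx> dsq B * delta (?a * ?u) + delta ?u * delta (?a * ?b) + dsq B * (delta ?u * dsq A)"
        using relation2[of A B "{j}"] fin insert.prems insert.hyps
        unfolding eq_mod_def by (simp add: sqf_even_singleton ac_simps)
      moreover have "\<dots> \<in> delta_form"
        using insert.prems by (intro delta_form_add delta_form_Y insert.IH delta_form_delta) auto
      ultimately have "dsq (insert j B) * dsq A \<in> delta_form"
        by (rule delta_form_cong)
      then have "Const (pprod P) * (Yprod I * (dsq (insert j B) * dsq A)) \<in> delta_form"
        using fin by (intro delta_form_PS delta_form_Yprod PS_pprod) auto
      then show ?case
        by (simp add: delta_std[OF std] ac_simps)
    qed (simp_all add: delta_form_0 delta_form_add delta_add distrib_left)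
  qed
qed (simp add: delta_form_0)

text \<open>Monomials in the symbols are built up from 1, which is \<open>eps 1\<close>, by
  multiplications that preserve normal forms; coefficients in \<open>PS\<close> preserve them
  too.\<close>

lemma F_subset_delta_form: "f \<in> F \<Longrightarrow> f \<in> delta_form"
proof -
  assume f: "f \<in> F"
  have var: "Var a ^ n * g \<in> delta_form" if g: "g \<in> delta_form" and a: "a \<in> pos_sqf_monomials" for a n g
  proof (induction n)
    case (Suc n)
    obtain A where "a = sqf_even A" "finite A" "A \<subseteq> {1..}" "A \<noteq> {}"
      using a by (auto simp: pos_sqf_monomials_def)
    then show ?case
      using delta_form_dsq[OF _ _ Suc, of A] by (simp add: dsq_Var mult.assoc)
  qed (simp add: g)
  have prod: "(\<Prod>v\<in>A. Var v ^ e v) * g \<in> delta_form" if "A \<subseteq> pos_sqf_monomials" "g \<in> delta_form" for A g and e :: "R \<Rightarrow> nat"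
    using that by (induction A rule: infinite_finite_induct) (auto simp: var mult.assoc)
  have "1 \<in> delta_form"
    using delta_form_Const[of 1] eps_pprod(1)[of "{}"] by simp
  then have mono: "(\<Prod>v\<in>A. Var v ^ e v) \<in> delta_form" if "A \<subseteq> pos_sqf_monomials" for A and e :: "R \<Rightarrow> nat"
    using prod[OF that, of 1 e] by simp
  have single: "Poly_Mapping.single m c = Const c * (\<Prod>v\<in>Poly_Mapping.keys m. Var v ^ Poly_Mapping.lookup m v)" for m :: "R \<Rightarrow>\<^sub>0 nat" and c :: R
  proof -
    have pow: "Var v ^ n = Poly_Mapping.single (Poly_Mapping.single v n) (1 :: R)" for v :: R and n
      by (induction n) (simp_all add: Var_def mult_single flip: single_add)
    have "(\<Prod>v\<in>A. Var v ^ Poly_Mapping.lookup m v) = Poly_Mapping.single (\<Sum>v\<in>A. Poly_Mapping.single v (Poly_Mapping.lookup m v)) (1 :: R)" for A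
      by (induction A rule: infinite_finite_induct) (simp_all add: pow mult_single)
    from this[of "Poly_Mapping.keys m"] show ?thesis
      by (simp add: poly_mapping_sum_single Const_def mult_single)
  qed
  have "(\<Sum>m\<in>Poly_Mapping.keys f. Poly_Mapping.single m (Poly_Mapping.lookup f m)) \<in> delta_form"
    unfolding single using f by (intro delta_form_sum delta_form_PS mono) (auto simp: F_def)
  then show "f \<in> delta_form"
    by (simp add: poly_mapping_sum_single)
qed

section \<open>The kernel and the presentation\<close>

lemma delta_eps: "delta (eps x) = 0"
proof (induction x rule: std_induct3)
  case (std P A I)
  then show ?case
    using delta_std[of P "{}" "{#}"] by (simp add: eps_std_elt std_indices_iff del: One_nat_def) (simp add: std_elt_eq del: One_nat_def)
qed (simp_all add: eps_add delta_add)

lemma kernel_in_rel_ideal: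
  assumes "f \<in> F" "F_to_S f = 0"
  shows "f \<in> rel_ideal"
proof -
  obtain c x where f: "f \<approx> Const (eps c) + delta x"
    using F_subset_delta_form[OF assms(1)] by (auto simp: delta_form_def)
  then have "F_to_S (f + (Const (eps c) + delta x)) = 0"
    unfolding eq_mod_def by (rule rel_ideal_in_kernel)
  then have "d x = eps c"
    by (simp add: assms(2) F_to_S_add F_to_S_Const F_to_S_delta add_eq_0_iff_eq)
  \<comment> \<open>The part \<open>eps x\<close> has no factor w_{2i}, so \<open>delta\<close>
    vanishes on it and only the \<open>delta\<close> of a value of \<open>d\<close> remains.\<close>
  from d_eq_eps[OF this] have "eps c = 0" "delta x = delta (eps x) + delta (d (htpy x))"
    by (simp_all flip: delta_add)
  then show ?thesis
    using f rel_ideal_add[OF _ delta_d_in_rel_ideal[of "htpy x"], of "f + delta (d (htpy x))"]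
    by (simp add: eq_mod_def delta_eps add.assoc)
qed

theorem theorem6p2:
  shows "F_to_S \<in> ring_hom (ring_on F) (ring_on S)
    \<and> (\<forall>c\<in>PS. F_to_S (Const c) = c)
    \<and> (\<forall>a\<in>pos_sqf_monomials. F_to_S (Var a) = a + omega a)
    \<and> F_to_S ` F = S
    \<and> a_kernel (ring_on F) (ring_on S) F_to_S = Idl\<^bsub>ring_on F\<^esub> (relations1 \<union> relations2)"
proof (intro conjI ballI)
  show "F_to_S \<in> ring_hom (ring_on F) (ring_on S)"
    by (rule ring_hom_memI) (simp_all add: F_to_S_in_S F_to_S_mult F_to_S_add F_to_S_1)
  show "F_to_S (Const c) = c" for c
    by (rule F_to_S_Const)
  show "F_to_S (Var a) = a + omega a" for a
    by (simp add: F_to_S_Var d_def)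
  show "F_to_S ` F = S"
  proof
    show "S \<subseteq> F_to_S ` F"
    proof
      fix s assume "s \<in> S"
      then have "s = F_to_S (Const (eps s) + delta (htpy s))"
        by (simp add: F_to_S_add F_to_S_Const F_to_S_delta flip: S_decomp)
      then show "s \<in> F_to_S ` F"
        by (rule image_eqI) (intro F_closed F_Const eps_in_PS delta_in_F)
    qed
  qed (auto simp: F_to_S_in_S)
  have "rel_ideal \<subseteq> F"
    using additive_subgroup.a_subset[OF ideal.axioms(1)[OF rel_ideal_ideal]] by simp
  then show "a_kernel (ring_on F) (ring_on S) F_to_S = Idl\<^bsub>ring_on F\<^esub> (relations1 \<union> relations2)"
    unfolding rel_ideal_def[symmetric] a_kernel_def' by (auto intro: kernel_in_rel_ideal rel_ideal_in_kernel)
qed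

end
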